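(* Let $A$ and $B$ be commutative unital real C$^*$-algebras and let $T: A\to B$ be an orthogonality preserving (real) linear bijection. Then $T$ is continuous.
   Context: A real C$^*$-algebra is a norm-closed real $^*$-subalgebra of a complex C$^*$-algebra. Elements $a,b$ of a real C$^*$-algebra are orthogonal, written $a\perp b$, if $ab^*=b^*a=0$. A map $T:A\to B$ between real C$^*$-algebras is orthogonality preserving if $a\perp b$ in $A$ implies $T(a)\perp T(b)$ in $B$. No continuity of $T$ is assumed, and $T^{-1}$ is not assumed to preserve orthogonality. *)

theory Defs
  imports "HOL-Analysis.Analysis"
begin

text \<open>
  Complex C*-algebras, not necessarily unital. The real scalar multiplication inherited from
  \<^class>\<open>real_normed_algebra\<close> is required to be the restriction of the complex one.
\<close>

class complex_cstar_algebra = real_normed_algebra + banach +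
  fixes scaleC :: "complex \<Rightarrow> 'a \<Rightarrow> 'a"  (infixr \<open>*\<^sub>C\<close> 75)
    and adj :: "'a \<Rightarrow> 'a"
  assumes scaleR_eq_scaleC: "r *\<^sub>R x = complex_of_real r *\<^sub>C x"
    and scaleC_add_right: "c *\<^sub>C (x + y) = c *\<^sub>C x + c *\<^sub>C y"
    and scaleC_add_left: "(c + d) *\<^sub>C x = c *\<^sub>C x + d *\<^sub>C x"
    and scaleC_scaleC: "c *\<^sub>C d *\<^sub>C x = (c * d) *\<^sub>C x"
    and scaleC_one: "1 *\<^sub>C x = x"
    and mult_scaleC_left: "(c *\<^sub>C x) * y = c *\<^sub>C (x * y)"
    and mult_scaleC_right: "x * (c *\<^sub>C y) = c *\<^sub>C (x * y)"
    and norm_scaleC: "norm (c *\<^sub>C x) = cmod c * norm x"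
    and adj_add: "adj (x + y) = adj x + adj y"
    and adj_scaleC: "adj (c *\<^sub>C x) = cnj c *\<^sub>C adj x"
    and adj_mult: "adj (x * y) = adj y * adj x"
    and adj_adj: "adj (adj x) = x"
    and norm_adj_mult_self: "norm (adj x * x) = (norm x)\<^sup>2"

definition real_cstar_algebra :: "'a::complex_cstar_algebra set \<Rightarrow> bool"
  where "real_cstar_algebra A \<longleftrightarrow>
    closed A \<and> subspace A \<and> (\<forall>x\<in>A. \<forall>y\<in>A. x * y \<in> A) \<and> (\<forall>x\<in>A. adj x \<in> A)"

text \<open>The unit of \<open>A\<close> need not be a unit of the ambient complex algebra, which may have none.\<close>

definition unital_on :: "'a::complex_cstar_algebra set \<Rightarrow> bool"
  where "unital_on A \<longleftrightarrow> (\<exists>e\<in>A. \<forall>x\<in>A. e * x = x \<and> x * e = x)"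

definition commutative_on :: "'a::complex_cstar_algebra set \<Rightarrow> bool"
  where "commutative_on A \<longleftrightarrow> (\<forall>x\<in>A. \<forall>y\<in>A. x * y = y * x)"

definition cstar_orthogonal :: "'a::complex_cstar_algebra \<Rightarrow> 'a \<Rightarrow> bool"
  where "cstar_orthogonal a b \<longleftrightarrow> a * adj b = 0 \<and> adj b * a = 0"

definition real_linear_on ::
  "'a::complex_cstar_algebra set \<Rightarrow> ('a \<Rightarrow> 'b::complex_cstar_algebra) \<Rightarrow> bool"
  where "real_linear_on A T \<longleftrightarrow>
    (\<forall>x\<in>A. \<forall>y\<in>A. T (x + y) = T x + T y) \<and> (\<forall>r. \<forall>x\<in>A. T (r *\<^sub>R x) = r *\<^sub>R T x)"

definition orthogonality_preserving_on ::
  "'a::complex_cstar_algebra set \<Rightarrow> ('a \<Rightarrow> 'b::complex_cstar_algebra) \<Rightarrow> bool"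
  where "orthogonality_preserving_on A T \<longleftrightarrow>
    (\<forall>a\<in>A. \<forall>b\<in>A. cstar_orthogonal a b \<longrightarrow> cstar_orthogonal (T a) (T b))"

end

theory Submission
  imports Defs
begin

text \<open>
  By the closed graph theorem it suffices that \<open>h\<^sub>n \<rightarrow> 0\<close> and \<open>T h\<^sub>n \<rightarrow> T p\<close> force \<open>p = 0\<close>. Let \<open>I\<close> be
  the ideal of all \<open>a\<close> for which \<open>w \<mapsto> T (a w)\<close> is continuous. If \<open>k \<in> I\<close> and \<open>e \<in> I\<close> satisfy
  \<open>e k = k\<close>, then \<open>T (e h\<^sub>n) \<rightarrow> 0\<close> while \<open>T (h\<^sub>n - e h\<^sub>n)\<close> is orthogonal to \<open>T (p k)\<close>, so \<open>T p\<close> is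
  orthogonal to \<open>T (p k)\<close>; from this one gets \<open>p I = 0\<close>. Hence \<open>p A\<close> contains no nonzero element of
  \<open>I\<close>. By a gliding hump \<open>p A\<close> contains no infinite sequence of pairwise orthogonal nonzero elements,
  so if \<open>p \<noteq> 0\<close> there is a nonzero \<open>a \<in> p A\<close> which cannot be split orthogonally. Such an \<open>a\<close> lives at
  one point of the spectrum, so that \<open>a A\<close> is at most two-dimensional and \<open>a \<in> I\<close>, a contradiction.
  Points of the spectrum are avoided throughout; the positive parts \<open>(h - t)\<^sup>+\<close> of self-adjoint
  elements replace bump functions.
\<close>

section \<open>The closed graph theorem on a closed subspace\<close>

text \<open>Baire's theorem on the complete set \<open>A\<close> yields a relative ball inside the
  closure of some \<open>V n\<close>. Hence every \<open>x\<close> is approximated to within half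
  its norm by vectors with controlled image; iterating writes \<open>T x\<close> as a series once
  the graph condition disposes of the remainder.\<close>

lemma closed_graph_bounded:
  fixes A :: "'a::banach set" and T :: "'a \<Rightarrow> 'b::banach"
  assumes A: "closed A" "subspace A"
    and T_add: "\<And>x y. \<lbrakk>x \<in> A; y \<in> A\<rbrakk> \<Longrightarrow> T (x + y) = T x + T y"
    and T_scaleR: "\<And>r x. x \<in> A \<Longrightarrow> T (r *\<^sub>R x) = r *\<^sub>R T x"
    and graph: "\<And>h g. \<lbrakk>\<And>n::nat. h n \<in> A; h \<longlonglongrightarrow> 0; (\<lambda>n. T (h n)) \<longlonglongrightarrow> g\<rbrakk> \<Longrightarrow> g = 0"
  obtains C where "C \<ge> 0" "\<And>x. x \<in> A \<Longrightarrow> norm (T x) \<le> C * norm x"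
proof -
  note mem = subspace_add[OF A(2)] subspace_diff[OF A(2)] subspace_scale[OF A(2)] subspace_0[OF A(2)]
  have T0: "T 0 = 0"
    using T_scaleR[of 0 0] mem by simp
  have T_diff: "T (x - y) = T x - T y" if "x \<in> A" "y \<in> A" for x y
    using T_add[of x "(-1) *\<^sub>R y"] T_scaleR[of y "-1"] mem(3)[of y "-1"] that by simp
  define V where "V n = {x \<in> A. norm (T x) \<le> real n}" for n :: nat
  have VA: "V n \<subseteq> A" "closure (V n) \<subseteq> A" for n
  proof -
    show "V n \<subseteq> A" by (auto simp: V_def)
    then show "closure (V n) \<subseteq> A" by (rule closure_minimal) (rule A(1))
  qed
  have cover: "(\<Union>n. closure (V n)) = A"
  proof
    show "A \<subseteq> (\<Union>n. closure (V n))"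
    proof
      fix x assume "x \<in> A"
      moreover obtain n where "norm (T x) \<le> real n"
        using real_arch_simple by blast
      ultimately have "x \<in> V n" by (simp add: V_def)
      then show "x \<in> (\<Union>n. closure (V n))" using closure_subset by blast
    qed
  qed (use VA in auto)
  have "\<exists>n. (top_of_set A) interior_of closure (V n) \<noteq> {}"
  proof (rule ccontr)
    assume "\<not> ?thesis"
    moreover have "closedin (top_of_set A) (closure (V n))" for n
      using VA by (auto simp: closedin_closed_eq[OF A(1)])
    moreover have "completely_metrizable_space (top_of_set A)"
      by (intro completely_metrizable_space_closedin completely_metrizable_space_euclidean)
        (use A(1) in auto)
    ultimately have "(top_of_set A) interior_of (\<Union>(range (\<lambda>n. closure (V n)))) = {}"
      by (intro Baire_category_alt) auto
    then show False
      using cover mem(4) interior_of_topspace[of "top_of_set A"] by auto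
  qed
  then obtain n x0 where "x0 \<in> (top_of_set A) interior_of closure (V n)" by blast
  then obtain U where U: "openin (top_of_set A) U" "x0 \<in> U" "U \<subseteq> closure (V n)"
    by (auto simp: interior_of_def)
  then obtain d where d: "d > 0" "x0 \<in> A" "\<And>x. \<lbrakk>x \<in> A; dist x x0 < d\<rbrakk> \<Longrightarrow> x \<in> closure (V n)"
    by (metis openin_euclidean_subtopology_iff subset_iff)
  \<comment> \<open>\<open>x\<close> is the difference of \<open>x0 + x\<close> and
    \<open>x0\<close>, both approximable from \<open>V n\<close>; hence the doubled bound.\<close>
  have near: "\<exists>y\<in>A. norm (x - y) < e \<and> norm (T y) \<le> 2 * real n"
    if x: "x \<in> A" "norm x < d" and "e > 0" for x e
  proof -
    have "x0 + x \<in> closure (V n)" "x0 \<in> closure (V n)"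
      using d x mem by (auto simp: dist_norm)
    then obtain y z where y: "y \<in> V n" "dist y (x0 + x) < e / 2" and z: "z \<in> V n" "dist z x0 < e / 2"
      using \<open>e > 0\<close> by (meson closure_approachable half_gt_zero)
    have "norm (x - (y - z)) \<le> norm (x0 + x - y) + norm (z - x0)"
      using norm_triangle_ineq[of "x0 + x - y" "z - x0"] by (simp add: algebra_simps)
    then have "norm (x - (y - z)) < e"
      using y z by (simp add: dist_norm norm_minus_commute)
    moreover have yz: "y \<in> A" "z \<in> A" "norm (T y) \<le> real n" "norm (T z) \<le> real n"
      using y z by (simp_all add: V_def)
    then have "norm (T (y - z)) \<le> 2 * real n"
      using T_diff[of y z] norm_triangle_ineq4[of "T y" "T z"] by simp
    moreover have "y - z \<in> A"
      using yz by (intro mem(2))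
    ultimately show ?thesis by blast
  qed
  \<comment> \<open>Rescaling \<open>x\<close> to norm \<open>d / 2\<close> and back turns the bound
    \<open>2 * real n\<close> into \<open>K * norm x\<close>.\<close>
  define K where "K = 4 * real n / d"
  have K: "K \<ge> 0" using d by (simp add: K_def)
  have step: "\<exists>y\<in>A. norm (x - y) \<le> norm x / 2 \<and> norm (T y) \<le> K * norm x" if x: "x \<in> A" for x
  proof (cases "x = 0")
    case True
    then show ?thesis using mem(4) T0 by (intro bexI[of _ 0]) auto
  next
    case False
    define c where "c = d / (2 * norm x)"
    have c: "c > 0" "c * norm x = d / 2" using False d by (auto simp: c_def)
    obtain y where y: "y \<in> A" "norm (c *\<^sub>R x - y) < c * norm x / 2" "norm (T y) \<le> 2 * real n"
      using near[OF mem(3)[OF x], of c "c * norm x / 2"] c d by auto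
    have "norm (x - (1/c) *\<^sub>R y) = norm (c *\<^sub>R x - y) / c"
    proof -
      have "x - (1/c) *\<^sub>R y = (1/c) *\<^sub>R (c *\<^sub>R x - y)" using c by (simp add: algebra_simps)
      then show ?thesis using c by simp
    qed
    also have "\<dots> \<le> norm x / 2"
      using y(2) c(1) by (simp add: field_simps)
    finally have "norm (x - (1/c) *\<^sub>R y) \<le> norm x / 2" .
    moreover have "norm (T ((1/c) *\<^sub>R y)) \<le> K * norm x"
      using y c T_scaleR[of y "1/c"] False d by (simp add: c_def K_def field_simps)
    ultimately show ?thesis using mem(3)[OF y(1), of "1/c"] by blast
  qed
  then obtain Y where Y: "\<And>x. x \<in> A \<Longrightarrow> Y x \<in> A"
    "\<And>x. x \<in> A \<Longrightarrow> norm (x - Y x) \<le> norm x / 2" "\<And>x. x \<in> A \<Longrightarrow> norm (T (Y x)) \<le> K * norm x"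
    by metis
  show ?thesis
  proof (rule that)
    show "2 * K \<ge> 0" using K by simp
  next
    fix x assume x: "x \<in> A"
    \<comment> \<open>\<open>X k\<close> is what remains of \<open>x\<close> after \<open>k\<close>
      approximations.\<close>
    define X where "X = rec_nat x (\<lambda>_ z. z - Y z)"
    have X0: "X 0 = x" and XS: "X (Suc k) = X k - Y (X k)" for k by (simp_all add: X_def)
    have XA: "X k \<in> A" for k by (induction k) (auto simp: X0 XS x Y intro: mem(2))
    have Xn: "norm (X k) \<le> norm x * (1/2) ^ k" for k
    proof (induction k)
      case (Suc k)
      then show ?case using Y(2)[OF XA[of k]] by (simp add: XS)
    qed (simp add: X0)
    have bnd: "norm (T (Y (X k))) \<le> K * norm x * (1/2) ^ k" for k
      using order_trans[OF Y(3)[OF XA] mult_left_mono[OF Xn K]] by (simp add: mult.assoc)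
    have sm: "summable (\<lambda>k. K * norm x * (1/2) ^ k)"
      by (intro summable_mult summable_geometric) auto
    have sums: "summable (\<lambda>k. T (Y (X k)))" and nsums: "summable (\<lambda>k. norm (T (Y (X k))))"
      by (rule summable_comparison_test[OF _ sm], use bnd in auto)+
    have TX: "T (X k) = T x - (\<Sum>j<k. T (Y (X j)))" for k
      by (induction k) (auto simp: X0 XS T_diff XA Y)
    have lim: "X \<longlonglongrightarrow> 0"
    proof (rule Lim_null_comparison)
      show "\<forall>\<^sub>F k in sequentially. norm (X k) \<le> norm x * (1/2) ^ k" using Xn by simp
      show "(\<lambda>k. norm x * (1/2) ^ k) \<longlonglongrightarrow> 0"
        by (intro tendsto_mult_right_zero LIMSEQ_power_zero) auto
    qed
    \<comment> \<open>Since \<open>X\<close> tends to 0, \<open>graph\<close> forces this limit to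
      be 0.\<close>
    have "(\<lambda>k. T (X k)) \<longlonglongrightarrow> T x - (\<Sum>k. T (Y (X k)))"
      unfolding TX by (intro tendsto_intros summable_LIMSEQ sums)
    then have "T x = (\<Sum>k. T (Y (X k)))"
      using graph[OF XA lim] eq_iff_diff_eq_0 by blast
    also have "norm \<dots> \<le> (\<Sum>k. norm (T (Y (X k))))"
      by (rule summable_norm[OF nsums])
    also have "\<dots> \<le> (\<Sum>k. K * norm x * (1/2) ^ k)"
      by (rule suminf_le[OF bnd nsums sm])
    also have "\<dots> = 2 * K * norm x"
      by (subst suminf_mult) (auto simp: suminf_geometric summable_geometric)
    finally show "norm (T x) \<le> 2 * K * norm x" .
  qed
qed

section \<open>The involution\<close>

context complex_cstar_algebra
begin

lemma adj_zero [simp]: "adj 0 = 0"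
  using adj_add[of 0 0] by simp

lemma adj_minus: "adj (- x) = - adj x"
  using adj_add[of x "- x"] by (simp add: eq_neg_iff_add_eq_0 add.commute)

lemma adj_diff: "adj (x - y) = adj x - adj y"
  using adj_add[of x "- y"] by (simp add: adj_minus)

lemma adj_scaleR: "adj (r *\<^sub>R x) = r *\<^sub>R adj x"
  by (simp add: scaleR_eq_scaleC adj_scaleC)

end

lemma norm_adj [simp]: "norm (adj x) = norm (x::'a::complex_cstar_algebra)"
proof -
  have le: "norm x \<le> norm (adj x)" for x :: 'a
  proof (cases "x = 0")
    case False
    have "(norm x)\<^sup>2 \<le> norm (adj x) * norm x"
      using norm_mult_ineq[of "adj x" x] by (simp add: norm_adj_mult_self)
    then show ?thesis using False by (simp add: power2_eq_square)
  qed simp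
  show ?thesis using le[of x] le[of "adj x"] by (simp add: adj_adj)
qed

lemma norm_mult_adj_self: "norm (x * adj x) = (norm (x::'a::complex_cstar_algebra))\<^sup>2"
  using norm_adj_mult_self[of "adj x"] by (simp add: adj_adj)

lemma mult_adj_self_eq_0 [simp]: "x * adj x = 0 \<longleftrightarrow> (x::'a::complex_cstar_algebra) = 0"
  using norm_mult_adj_self[of x] by fastforce

lemma bounded_linear_adj: "bounded_linear (adj :: 'a::complex_cstar_algebra \<Rightarrow> 'a)"
  by (rule bounded_linear_intro[where K = 1]) (auto simp: adj_add adj_scaleR)

lemmas tendsto_adj [tendsto_intros] = bounded_linear.tendsto[OF bounded_linear_adj]

lemma cstar_orthogonal_sym: "cstar_orthogonal a b \<Longrightarrow> cstar_orthogonal b a"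
  unfolding cstar_orthogonal_def by (metis adj_adj adj_mult adj_zero)

lemma cstar_orthogonal_diff:
  assumes "cstar_orthogonal x z" "cstar_orthogonal y z"
  shows "cstar_orthogonal (x - y) z"
  using assms by (simp add: cstar_orthogonal_def left_diff_distrib right_diff_distrib)

lemma cstar_orthogonal_add:
  assumes "cstar_orthogonal x z" "cstar_orthogonal y z"
  shows "cstar_orthogonal (x + y) z"
  using assms by (simp add: cstar_orthogonal_def distrib_left distrib_right)

lemma cstar_orthogonal_limit:
  assumes "f \<longlonglongrightarrow> x" "\<And>n. cstar_orthogonal (f n) z"
  shows "cstar_orthogonal x z"
proof -
  have "(\<lambda>n. f n * adj z) \<longlonglongrightarrow> x * adj z" "(\<lambda>n. adj z * f n) \<longlonglongrightarrow> adj z * x"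
    by (intro tendsto_intros assms)+
  then show ?thesis
    using assms(2) by (simp add: cstar_orthogonal_def LIMSEQ_const_iff)
qed

text \<open>Multiplying \<open>x + y\<close> by \<open>adj x\<close> removes \<open>y\<close>, and
  the C*-identity evaluates what is left.\<close>

lemma norm_le_norm_add_orthogonal:
  assumes "cstar_orthogonal x y"
  shows "norm x \<le> norm (x + y)"
proof (cases "x = 0")
  case False
  have "(x + y) * adj x = x * adj x"
    using cstar_orthogonal_sym[OF assms] by (simp add: cstar_orthogonal_def distrib_right)
  then have "(norm x)\<^sup>2 \<le> norm (x + y) * norm x"
    using norm_mult_ineq[of "x + y" "adj x"] by (simp add: norm_mult_adj_self)
  then show ?thesis using False by (simp add: power2_eq_square)
qed simp

section \<open>Order and lattice structure of the self-adjoint part\<close>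

locale commutative_real_cstar =
  fixes A :: "'a::complex_cstar_algebra set" and u :: 'a
  assumes closed: "closed A" and subsp: "subspace A"
    and mult_mem [simp]: "\<lbrakk>x \<in> A; y \<in> A\<rbrakk> \<Longrightarrow> x * y \<in> A"
    and adj_mem [simp]: "x \<in> A \<Longrightarrow> adj x \<in> A"
    and comm: "\<lbrakk>x \<in> A; y \<in> A\<rbrakk> \<Longrightarrow> x * y = y * x"
    and unit_mem [simp]: "u \<in> A"
    and unit_left [simp]: "x \<in> A \<Longrightarrow> u * x = x"
begin

lemma add_mem [simp]: "\<lbrakk>x \<in> A; y \<in> A\<rbrakk> \<Longrightarrow> x + y \<in> A"
  and diff_mem [simp]: "\<lbrakk>x \<in> A; y \<in> A\<rbrakk> \<Longrightarrow> x - y \<in> A"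
  and scaleR_mem [simp]: "x \<in> A \<Longrightarrow> c *\<^sub>R x \<in> A"
  and zero_mem [simp]: "0 \<in> A"
  and minus_mem [simp]: "x \<in> A \<Longrightarrow> - x \<in> A"
  using subsp by (auto simp: subspace_add subspace_diff subspace_scale subspace_0 subspace_neg)

lemma unit_right [simp]: "x \<in> A \<Longrightarrow> x * u = x"
  using comm[of x u] by simp

lemma left_comm: "\<lbrakk>x \<in> A; y \<in> A\<rbrakk> \<Longrightarrow> x * (y * z) = y * (x * z)"
  using comm[of x y] by (simp flip: mult.assoc)

lemma adj_unit [simp]: "adj u = u"
proof -
  have "adj u * u = adj (adj u * u)" by (simp only: adj_mult adj_adj)
  then show ?thesis by (simp add: adj_adj)
qed

text \<open>The C*-identity makes \<open>norm u\<close> idempotent; equality with 1 fails in the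
  zero algebra, where \<open>u = 0\<close>.\<close>

lemma norm_unit_le: "norm u \<le> 1"
proof -
  have "(norm u)\<^sup>2 = norm u" using norm_adj_mult_self[of u] by simp
  then show ?thesis by (cases "norm u = 0") (auto simp: power2_eq_square)
qed

lemma orthogonalI: "\<lbrakk>x \<in> A; y \<in> A; x * adj y = 0\<rbrakk> \<Longrightarrow> cstar_orthogonal x y"
  using comm[of x "adj y"] by (simp add: cstar_orthogonal_def)

section \<open>Self-adjoint elements\<close>

definition sa :: "'a \<Rightarrow> bool"
  where "sa x \<longleftrightarrow> x \<in> A \<and> adj x = x"

lemma sa_mem: "sa x \<Longrightarrow> x \<in> A"
  by (simp add: sa_def)

lemma sa_zero [simp]: "sa 0" and sa_unit [simp]: "sa u"
  by (auto simp: sa_def)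

lemma sa_add [simp]: "\<lbrakk>sa x; sa y\<rbrakk> \<Longrightarrow> sa (x + y)"
  and sa_diff [simp]: "\<lbrakk>sa x; sa y\<rbrakk> \<Longrightarrow> sa (x - y)"
  and sa_minus [simp]: "sa x \<Longrightarrow> sa (- x)"
  and sa_scaleR [simp]: "sa x \<Longrightarrow> sa (c *\<^sub>R x)"
  by (auto simp: sa_def adj_add adj_diff adj_minus adj_scaleR)

lemma sa_mult [simp]: "\<lbrakk>sa x; sa y\<rbrakk> \<Longrightarrow> sa (x * y)"
  using comm[of x y] by (auto simp: sa_def adj_mult)

lemma sa_mult_adj: "x \<in> A \<Longrightarrow> sa (x * adj x)"
  by (auto simp: sa_def adj_mult adj_adj)

lemma sa_limit:
  assumes "f \<longlonglongrightarrow> x" "\<And>n. sa (f n)"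
  shows "sa x"
proof -
  have "x \<in> A"
    using closed assms by (auto simp: sa_def closed_sequential_limits)
  moreover have "(\<lambda>n. adj (f n)) \<longlonglongrightarrow> adj x"
    by (intro tendsto_intros assms)
  then have "f \<longlonglongrightarrow> adj x"
    using assms(2) by (simp add: sa_def)
  then have "adj x = x"
    using assms(1) LIMSEQ_unique by blast
  ultimately show ?thesis by (simp add: sa_def)
qed

lemma norm_square: "sa x \<Longrightarrow> norm (x * x) = (norm x)\<^sup>2"
  using norm_adj_mult_self[of x] by (simp add: sa_def)

lemma square_eq_0: "sa x \<Longrightarrow> x * x = 0 \<longleftrightarrow> x = 0"
  using norm_square[of x] by fastforce

lemma cube_eq_0:
  assumes "sa x" "x * (x * x) = 0"
  shows "x = 0"
proof -
  have "(x * x) * (x * x) = 0" using assms by (simp add: mult.assoc)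
  then show ?thesis using assms square_eq_0[of x] square_eq_0[of "x * x"] by simp
qed

text \<open>The self-adjoint \<open>x * adj x\<close> also squares to 0 and therefore
  vanishes.\<close>

lemma square_mem_eq_0:
  assumes "x \<in> A" "x * x = 0"
  shows "x = 0"
proof -
  have "(x * adj x) * (x * adj x) = (x * x) * (adj x * adj x)"
    using assms comm[of x "adj x"] left_comm[of x "adj x"] by (simp add: mult.assoc)
  then have "(x * adj x) * (x * adj x) = 0" using assms by simp
  then have "x * adj x = 0" using square_eq_0[of "x * adj x"] sa_mult_adj[OF assms(1)] by simp
  then show ?thesis by simp
qed

text \<open>Both squares are dominated because \<open>r\<close> is the real part of \<open>r + i s\<close>.\<close>

lemma norm_square_le_norm_sum_squares:
  assumes r: "sa r" and s: "sa s"
  shows "norm (r * r) \<le> norm (r * r + s * s)"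
proof -
  \<comment> \<open>\<open>x\<close> lives in the ambient complex algebra and may lie outside
    \<open>A\<close>; the C*-identity there compares the norms.\<close>
  define x where "x = r + \<i> *\<^sub>C s"
  have rs: "r * s = s * r" "adj r = r" "adj s = s" using r s comm by (auto simp: sa_def)
  have ii: "\<i> *\<^sub>C (- \<i>) *\<^sub>C z = z" "(- \<i>) *\<^sub>C \<i> *\<^sub>C z = z" for z :: 'a
    by (simp_all add: scaleC_scaleC scaleC_one)
  have i0: "\<i> *\<^sub>C z + (- \<i>) *\<^sub>C z = 0" for z :: 'a
    using scaleC_add_left[of "\<i>" "- \<i>" z] scaleR_eq_scaleC[of 0 z] by simp
  have adjx: "adj x = r + (- \<i>) *\<^sub>C s"
    by (simp add: x_def adj_add adj_scaleC rs)
  have "adj x * x = r * r + s * s + (\<i> *\<^sub>C (r * s) + (- \<i>) *\<^sub>C (r * s))"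
    unfolding adjx unfolding x_def using rs(1)
    by (simp add: distrib_left distrib_right mult_scaleC_left mult_scaleC_right scaleC_add_right ii add_ac)
  then have "(norm x)\<^sup>2 = norm (r * r + s * s)"
    using norm_adj_mult_self[of x] by (simp add: i0)
  moreover have "x + adj x = 2 *\<^sub>R r"
    using i0[of s] unfolding adjx unfolding x_def by (simp add: scaleR_2 algebra_simps)
  then have "2 * norm r \<le> norm x + norm x"
    using norm_triangle_ineq[of x "adj x"] by simp
  then have "(norm r)\<^sup>2 \<le> (norm x)\<^sup>2"
    by (simp add: power_mono)
  ultimately show ?thesis using norm_square[OF r] by simp
qed

section \<open>The positive cone and square roots\<close>

text \<open>For self-adjoint \<open>z\<close> this is the usual positivity of the spectrum.\<close>

definition pos :: "'a \<Rightarrow> bool"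
  where "pos z \<longleftrightarrow> sa z \<and> (\<exists>c\<ge>0. norm (c *\<^sub>R u - z) \<le> c)"

lemma pos_sa: "pos z \<Longrightarrow> sa z"
  by (simp add: pos_def)

lemma pos_mem: "pos z \<Longrightarrow> z \<in> A"
  by (simp add: pos_def sa_def)

lemma pos_add [simp]:
  assumes "pos x" "pos y"
  shows "pos (x + y)"
proof -
  obtain c d where "c \<ge> 0" "d \<ge> 0" "norm (c *\<^sub>R u - x) \<le> c" "norm (d *\<^sub>R u - y) \<le> d"
    using assms by (auto simp: pos_def)
  then have "norm ((c + d) *\<^sub>R u - (x + y)) \<le> c + d"
    using norm_triangle_ineq[of "c *\<^sub>R u - x" "d *\<^sub>R u - y"] by (simp add: algebra_simps)
  then show ?thesis
    using assms \<open>c \<ge> 0\<close> \<open>d \<ge> 0\<close> unfolding pos_def by (intro conjI exI[of _ "c + d"]) auto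
qed

lemma pos_scaleR [simp]:
  assumes "pos x" "r \<ge> 0"
  shows "pos (r *\<^sub>R x)"
proof -
  obtain c where "c \<ge> 0" "norm (c *\<^sub>R u - x) \<le> c"
    using assms by (auto simp: pos_def)
  moreover have "norm ((r * c) *\<^sub>R u - r *\<^sub>R x) = r * norm (c *\<^sub>R u - x)"
    using assms by (simp flip: scaleR_scaleR scaleR_diff_right)
  ultimately show ?thesis
    using assms unfolding pos_def by (intro conjI exI[of _ "r * c"]) (auto intro: mult_left_mono)
qed

lemma pos_unit_diff:
  assumes "sa z" "norm z \<le> t"
  shows "pos (t *\<^sub>R u - z)"
proof -
  have "t \<ge> 0" using assms(2) norm_ge_zero order_trans by blast
  then show ?thesis using assms unfolding pos_def by (intro conjI exI[of _ t]) auto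
qed

lemma pos_zero [simp]: "pos 0"
  using pos_unit_diff[of 0 0] by simp

lemma pos_unit [simp]: "pos u"
  using pos_unit_diff[of 0 1] by simp

text \<open>
  The square root is \<open>u - y\<close>, where \<open>y\<close> is the limit of \<open>y \<mapsto> (x + y\<^sup>2)/2\<close> started at \<open>0\<close>; the
  increments are dominated by those of the same scalar iteration for \<open>x = 1\<close>.
\<close>

lemma sqrt_unit_minus:
  assumes x: "sa x" "norm x \<le> 1"
  obtains y where "sa y" "norm y \<le> 1" "(u - y) * (u - y) = u - x"
proof -
  define Y where "Y = rec_nat 0 (\<lambda>_ y. (1/2) *\<^sub>R (x + y * y))"
  define \<eta> where "\<eta> = rec_nat (0::real) (\<lambda>_ t. (1 + t\<^sup>2) / 2)"
  have Y0: "Y 0 = 0" and YS: "Y (Suc n) = (1/2) *\<^sub>R (x + Y n * Y n)" for n by (simp_all add: Y_def)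
  have e0: "\<eta> 0 = 0" and eS: "\<eta> (Suc n) = (1 + (\<eta> n)\<^sup>2) / 2" for n by (simp_all add: \<eta>_def)
  have saY: "sa (Y n)" for n by (induction n) (auto simp: Y0 YS x)
  have eta: "0 \<le> \<eta> n" "\<eta> n \<le> 1" for n
    by (induction n) (auto simp: e0 eS power_le_one)
  have nY: "norm (Y n) \<le> \<eta> n" for n
  proof (induction n)
    case (Suc n)
    have "norm (x + Y n * Y n) \<le> 1 + (norm (Y n))\<^sup>2"
      using norm_triangle_ineq[of x "Y n * Y n"] x norm_square[OF saY] by simp
    also have "\<dots> \<le> 1 + (\<eta> n)\<^sup>2" using Suc by (simp add: power_mono)
    finally show ?case by (simp add: YS eS)
  qed (simp add: Y0 e0)
  have incr: "norm (Y (Suc n) - Y n) \<le> \<eta> (Suc n) - \<eta> n" for n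
  proof (induction n)
    case 0
    then show ?case using x by (simp add: Y0 YS e0 eS)
  next
    case (Suc n)
    note YA = saY[THEN sa_mem]
    have "Y (Suc (Suc n)) - Y (Suc n) = (1/2) *\<^sub>R (Y (Suc n) * Y (Suc n) - Y n * Y n)"
      by (subst YS, subst (2) YS) (simp flip: scaleR_diff_right)
    also have "Y (Suc n) * Y (Suc n) - Y n * Y n = (Y (Suc n) - Y n) * (Y (Suc n) + Y n)"
      using comm[OF YA YA, of "Suc n" n] by (simp add: distrib_left left_diff_distrib)
    finally have "Y (Suc (Suc n)) - Y (Suc n) = (1/2) *\<^sub>R ((Y (Suc n) - Y n) * (Y (Suc n) + Y n))" .
    then have "norm (Y (Suc (Suc n)) - Y (Suc n)) \<le> (norm (Y (Suc n) - Y n) * norm (Y (Suc n) + Y n)) / 2"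
      using norm_mult_ineq[of "Y (Suc n) - Y n" "Y (Suc n) + Y n"] by simp
    also have "\<dots> \<le> ((\<eta> (Suc n) - \<eta> n) * (\<eta> (Suc n) + \<eta> n)) / 2"
      using Suc order_trans[OF norm_ge_zero Suc] norm_triangle_mono[OF nY nY, of "Suc n" n]
      by (intro divide_right_mono mult_mono) (auto intro: order_trans[OF norm_ge_zero])
    also have "\<dots> = (1 + (\<eta> (Suc n))\<^sup>2) / 2 - (1 + (\<eta> n)\<^sup>2) / 2"
      by (simp add: field_simps power2_eq_square)
    also have "\<dots> = \<eta> (Suc (Suc n)) - \<eta> (Suc n)"
      by (simp only: eS)
    finally show ?case .
  qed
  have "incseq \<eta>"
    using order_trans[OF norm_ge_zero incr] by (intro incseq_SucI) simp
  then have "convergent \<eta>"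
    using eta by (intro Bseq_mono_convergent BseqI'[of _ 1]) (auto simp: mono_def)
  \<comment> \<open>The increments of the convergent \<open>\<eta>\<close> telescope, and they
    majorise those of \<open>Y\<close>.\<close>
  then have "summable (\<lambda>n. \<eta> (Suc n) - \<eta> n)"
    by (simp add: telescope_summable convergent_LIMSEQ_iff)
  then have "summable (\<lambda>n. Y (Suc n) - Y n)"
    by (rule summable_comparison_test[rotated]) (use incr in auto)
  then have "(\<lambda>n. \<Sum>k<n. Y (Suc k) - Y k) \<longlonglongrightarrow> (\<Sum>n. Y (Suc n) - Y n)"
    by (rule summable_LIMSEQ)
  then obtain y where y: "Y \<longlonglongrightarrow> y"
    by (auto simp: sum_lessThan_telescope Y0)
  have sy: "sa y" using sa_limit[OF y saY] .
  have "norm y \<le> 1"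
    using tendsto_norm[OF y] nY eta by (meson LIMSEQ_le_const2 order_trans)
  \<comment> \<open>In the limit the recursion reads \<open>2 y = x + y * y\<close>, a rearrangement
    of the claimed equation.\<close>
  moreover have "(\<lambda>n. Y (Suc n)) \<longlonglongrightarrow> (1/2) *\<^sub>R (x + y * y)"
    unfolding YS by (intro tendsto_intros y)
  then have "y = (1/2) *\<^sub>R (x + y * y)"
    using LIMSEQ_Suc[OF y] LIMSEQ_unique by blast
  then have "2 *\<^sub>R y = x + y * y"
    by (metis (no_types) scaleR_scaleR scaleR_one mult.commute nonzero_mult_div_cancel_left
        times_divide_eq_right zero_neq_numeral mult_1_right)
  then have "(u - y) * (u - y) = u - x"
    using sa_mem[OF sy] by (simp add: algebra_simps scaleR_2)
  ultimately show ?thesis using that sy by blast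
qed

text \<open>Dividing by the constant \<open>c\<close> from \<open>pos\<close> gives
  \<open>u - x\<close> with \<open>norm x <= 1\<close>. The root \<open>u - y\<close> of the latter
  is positive because \<open>norm y <= 1\<close>.\<close>

lemma pos_sqrt:
  assumes "pos z"
  obtains r where "pos r" "r * r = z"
proof -
  obtain c where c: "c \<ge> 0" "norm (c *\<^sub>R u - z) \<le> c" and z: "sa z"
    using assms by (auto simp: pos_def)
  show ?thesis
  proof (cases "c = 0")
    case True
    then show ?thesis using c that[of 0] by simp
  next
    case False
    then have "c > 0" using c by simp
    define x where "x = u - (1/c) *\<^sub>R z"
    have "x = (1/c) *\<^sub>R (c *\<^sub>R u - z)" using \<open>c > 0\<close> by (simp add: x_def algebra_simps)
    then have "norm x = norm (c *\<^sub>R u - z) / c" using \<open>c > 0\<close> by simp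
    then have "norm x \<le> 1" using c \<open>c > 0\<close> by simp
    moreover have "sa x" using z by (simp add: x_def)
    ultimately obtain y where y: "sa y" "norm y \<le> 1" "(u - y) * (u - y) = u - x"
      using sqrt_unit_minus by blast
    have "pos (sqrt c *\<^sub>R (u - y))"
      using pos_unit_diff[OF y(1,2)] c by simp
    moreover have "(sqrt c *\<^sub>R (u - y)) * (sqrt c *\<^sub>R (u - y)) = z"
      using y(3) \<open>c > 0\<close> by (simp add: x_def)
    ultimately show ?thesis using that by blast
  qed
qed

text \<open>After normalising to \<open>norm s <= 1\<close>, the element \<open>u - s * s\<close> is
  itself the square of \<open>u - y\<close>. The two squares add up to \<open>u\<close>, so
  \<open>norm (u - s * s) <= norm u <= 1\<close>, which is \<open>pos\<close> with
  \<open>c = 1\<close>.\<close>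

lemma pos_square [simp]:
  assumes r: "sa r"
  shows "pos (r * r)"
proof -
  have unit: "norm (u - s * s) \<le> 1" if s: "sa s" "norm s \<le> 1" for s
  proof -
    have "norm (s * s) \<le> 1" using s by (simp add: norm_square power_le_one)
    then obtain y where y: "sa y" "(u - y) * (u - y) = u - s * s"
      using sqrt_unit_minus[of "s * s"] s by auto
    have "norm ((u - y) * (u - y)) \<le> norm ((u - y) * (u - y) + s * s)"
      using s y by (intro norm_square_le_norm_sum_squares) auto
    then show ?thesis using y norm_unit_le by simp
  qed
  show ?thesis
  proof (cases "r = 0")
    case False
    define s where "s = (1 / norm r) *\<^sub>R r"
    have "sa s" "norm s \<le> 1" using r False by (auto simp: s_def)
    then have "pos (s * s)"
      using unit by (auto simp: pos_def intro!: exI[of _ 1])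
    then have "pos ((norm r)\<^sup>2 *\<^sub>R (s * s))" by simp
    then show ?thesis using False by (simp add: s_def power2_eq_square)
  qed simp
qed

lemma pos_mult [simp]:
  assumes "pos x" "pos y"
  shows "pos (x * y)"
proof -
  obtain r s where r: "pos r" "x = r * r" and s: "pos s" "y = s * s"
    using assms by (metis pos_sqrt)
  then have "x * y = (r * s) * (r * s)"
    using left_comm[of r s] comm[of r s] by (simp add: pos_mem mult.assoc)
  then show ?thesis using r s by (simp add: pos_sa)
qed

lemma norm_le_norm_add_pos:
  assumes "pos x" "pos y"
  shows "norm x \<le> norm (x + y)"
proof -
  obtain r s where "pos r" "x = r * r" "pos s" "y = s * s"
    using assms by (metis pos_sqrt)
  then show ?thesis by (simp add: norm_square_le_norm_sum_squares pos_sa)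
qed

lemma pos_add_eq_0:
  assumes "pos x" "pos y" "x + y = 0"
  shows "x = 0" "y = 0"
  using norm_le_norm_add_pos[OF assms(1,2)] assms(3) by auto

lemma pos_minus_eq_0: "\<lbrakk>pos x; pos (- x)\<rbrakk> \<Longrightarrow> x = 0"
  using pos_add_eq_0[of x "- x"] by simp

lemma norm_mono: "\<lbrakk>pos x; pos (y - x)\<rbrakk> \<Longrightarrow> norm x \<le> norm y"
  using norm_le_norm_add_pos[of x "y - x"] by simp

text \<open>\<open>w\<close> plays the modulus of \<open>p\<close>, and \<open>d\<close> twice its
  negative part. As \<open>d * q = 0\<close>, the positive element \<open>d * d * (p + q)\<close>
  equals \<open>- (d * d * w)\<close> and must vanish; then \<open>d\<close> has cube 0, so
  \<open>d = 0\<close> and \<open>p = w\<close>.\<close>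

lemma pos_disjoint_sum:
  assumes p: "sa p" and q: "sa q" and pq: "p * q = 0" and sum: "pos (p + q)"
  shows "pos p"
proof -
  obtain w where w: "pos w" "w * w = p * p" using pos_sqrt[OF pos_square[OF p]] .
  define d where "d = w - p"
  have d: "sa d" using p w by (simp add: d_def pos_sa)
  have A: "p \<in> A" "q \<in> A" "w \<in> A" "d \<in> A" using p q w d by (auto simp: sa_mem pos_mem)
  have "(w * q) * (w * q) = (w * w) * (q * q)"
    using A comm[of w q] left_comm[of w q] by (simp add: mult.assoc)
  also have "\<dots> = p * ((p * q) * q)"
    using w by (simp add: mult.assoc)
  finally have "w * q = 0"
    using pq square_eq_0[of "w * q"] w q by (simp add: pos_sa)
  then have dq: "d * q = 0" using pq by (simp add: d_def left_diff_distrib)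
  have dd: "d * d = 2 *\<^sub>R (w * d)" and dp: "d * p = - (w * d)"
    using w(2) A comm[of p w] by (simp_all add: d_def algebra_simps scaleR_2)
  have "d * d * (p + q) = - (d * d * w)"
    using A dq dp comm[of w d] by (simp add: mult.assoc distrib_left)
  moreover have "pos (d * d * (p + q))" "pos (d * d * w)"
    using sum d w by simp_all
  ultimately have "d * d * w = 0"
    by (metis pos_minus_eq_0)
  moreover have "d * (d * d) = d * (2 *\<^sub>R (w * d))" by (simp only: dd)
  then have "d * (d * d) = 2 *\<^sub>R (d * d * w)"
    using A comm[of w d] by (simp add: mult.assoc)
  ultimately have "d * (d * d) = 0" by simp
  then have "d = 0" using cube_eq_0 d by blast
  then show ?thesis using w by (simp add: d_def)
qed

section \<open>Positive and negative parts\<close>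

text \<open>The chosen root plays the modulus of \<open>h\<close>. Because
  \<open>(- h) * (- h)\<close> is \<open>h * h\<close>, the same root is chosen for
  \<open>- h\<close>, so \<open>pospart (- h)\<close> is the negative part of
  \<open>h\<close>.\<close>

definition pospart :: "'a \<Rightarrow> 'a"
  where "pospart h = (1/2) *\<^sub>R ((SOME r. pos r \<and> r * r = h * h) + h)"

lemma pospart_aux:
  assumes h: "sa h"
  shows pos_pospart [simp]: "pos (pospart h)"
    and pospart_mult_neg: "pospart h * pospart (- h) = 0"
    and pospart_diff_neg: "pospart h - pospart (- h) = h"
proof -
  define r where "r = (SOME r. pos r \<and> r * r = h * h)"
  have "\<exists>r. pos r \<and> r * r = h * h" using pos_sqrt[OF pos_square[OF h]] by metis
  then have r: "pos r" "r * r = h * h"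
    unfolding r_def by (metis (mono_tags, lifting) someI_ex)+
  have p: "pospart h = (1/2) *\<^sub>R (r + h)" and n: "pospart (- h) = (1/2) *\<^sub>R (r - h)"
    by (simp_all add: pospart_def r_def)
  show diff: "pospart h - pospart (- h) = h"
    by (simp add: p n flip: scaleR_diff_right)
  have "r * h = h * r" using h r comm by (simp add: sa_mem pos_mem)
  then show mult: "pospart h * pospart (- h) = 0"
    using r(2) by (simp add: p n algebra_simps)
  \<comment> \<open>The two parts have product 0 and positive sum \<open>r\<close>, the situation of
    \<open>pos_disjoint_sum\<close>.\<close>
  have "pospart h + pospart (- h) = r"
    by (simp add: p n flip: scaleR_add_right)
  then have sum: "pos (pospart h + pospart (- h))" using r by simp
  have "sa (pospart h)" "sa (pospart (- h))"
    unfolding p n using h pos_sa[OF r(1)] by (intro sa_scaleR sa_add sa_diff; simp)+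
  then show "pos (pospart h)"
    using mult sum by (rule pos_disjoint_sum)
qed

lemma sa_pospart [simp]: "sa h \<Longrightarrow> sa (pospart h)"
  by (simp add: pos_sa)

lemma pospart_mem [simp]: "sa h \<Longrightarrow> pospart h \<in> A"
  by (simp add: sa_mem)

lemma pospart_mult_self:
  assumes "sa h"
  shows "pospart h * h = pospart h * pospart h"
  using pospart_mult_neg[OF assms] pospart_diff_neg[OF assms] right_diff_distrib[of "pospart h" "pospart h"]
  by (metis diff_zero)

lemma pospart_neg_mult_self: "sa h \<Longrightarrow> pospart (- h) * h = - (pospart (- h) * pospart (- h))"
  using pospart_mult_self[of "- h"] by (metis minus_minus mult_minus_right sa_minus)

lemma pospart_eq_0:
  assumes "sa h" "pos (- h)"
  shows "pospart h = 0"
proof -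
  have "pos (pospart h * (- h))" using assms by (intro pos_mult) simp_all
  then have "pos (- (pospart h * pospart h))"
    using assms by (simp add: pospart_mult_self)
  then have "pospart h * pospart h = 0" using assms by (intro pos_minus_eq_0) auto
  then show ?thesis using assms by (simp add: square_eq_0)
qed

text \<open>The positive element \<open>(a * b) * (y - x)\<close> equals minus the sum of the
  positive elements \<open>a * b * b\<close> and \<open>a * a * b\<close>, so both vanish, and with
  them the square of \<open>a * b\<close>.\<close>

lemma pospart_mult_neg_mono:
  assumes x: "sa x" and y: "sa y" and le: "pos (y - x)"
  shows "pospart x * pospart (- y) = 0"
proof -
  define a b where "a = pospart x" and "b = pospart (- y)"
  have ab: "pos a" "pos b" using x y by (simp_all add: a_def b_def)
  note A = ab[THEN pos_mem] x[THEN sa_mem] y[THEN sa_mem]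
  have bx: "a * x = a * a" and yb: "b * y = - (b * b)"
    using pospart_mult_self[OF x] pospart_neg_mult_self[OF y] by (simp_all add: a_def b_def)
  have "(a * b) * (y - x) = a * (b * y) - b * (a * x)"
    using A comm[of a b] by (simp add: right_diff_distrib mult.assoc) (simp add: left_comm)
  also have "\<dots> = - (a * b * b + a * a * b)"
    using A comm[of b "a * a"] by (simp add: bx yb mult.assoc)
  finally have "(a * b) * (y - x) = - (a * b * b + a * a * b)" .
  moreover have "pos ((a * b) * (y - x))" "pos (a * b * b)" "pos (a * a * b)"
    using ab le by simp_all
  ultimately have "a * a * b = 0"
    using pos_add_eq_0(2)[of "a * b * b" "a * a * b"] pos_minus_eq_0[of "a * b * b + a * a * b"] by simp
  moreover have "a * b * (a * b) = (a * a * b) * b"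
    using A comm[of b "a * b"] by (simp add: mult.assoc)
  ultimately have "a * b * (a * b) = 0" by simp
  then show ?thesis
    using ab square_eq_0[of "a * b"] by (simp add: pos_sa a_def b_def)
qed

text \<open>The negative part \<open>n\<close> of the difference \<open>D\<close> satisfies
  \<open>n * D = - (n * n)\<close>. Multiplying by \<open>y'\<close> and then by \<open>X\<close>
  shows that \<open>n\<close> annihilates both; what remains, \<open>n * Y + n * n = 0\<close>, is a
  vanishing sum of positive elements.\<close>

lemma pospart_mono:
  assumes x: "sa x" and y: "sa y" and le: "pos (y - x)"
  shows "pos (pospart y - pospart x)"
proof -
  define D where "D = pospart y - pospart x"
  define n where "n = pospart (- D)"
  define X Y x' y' where "X = pospart x" and "Y = pospart y" and "x' = pospart (- x)" and "y' = pospart (- y)"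
  have D: "sa D" using x y by (simp add: D_def)
  have pos: "pos n" "pos X" "pos Y" "pos x'" "pos y'"
    using x y D by (simp_all add: n_def X_def Y_def x'_def y'_def)
  note A = pos[THEN pos_mem] x[THEN sa_mem] y[THEN sa_mem]
  have Yy: "Y * y' = 0" and Xx: "X * x' = 0" and Xy: "X * y' = 0"
    using x y le by (simp_all add: X_def Y_def x'_def y'_def pospart_mult_neg pospart_mult_neg_mono)
  have "n * D = - (n * n)"
    using pospart_neg_mult_self[OF D] by (simp add: n_def)
  then have nD: "n * Y - n * X = - (n * n)"
    by (simp add: D_def X_def Y_def right_diff_distrib)
  then have "(n * Y - n * X) * y' = - (n * n) * y'" by simp
  then have nny: "n * n * y' = 0"
    by (simp add: left_diff_distrib mult.assoc Yy Xy)
  have "(n * y') * (n * y') = (n * n * y') * y'"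
    using A comm[of y' "n * y'"] by (simp add: mult.assoc)
  then have ny: "n * y' = 0"
    using nny square_eq_0[of "n * y'"] pos by (simp add: pos_sa)
  \<comment> \<open>After multiplication by \<open>n\<close> and \<open>X\<close> only the term with
    \<open>y - x\<close> survives, and it is positive.\<close>
  have "Y - X = (y - x) + y' - x'"
    using pospart_diff_neg[OF x] pospart_diff_neg[OF y]
    by (simp add: X_def Y_def x'_def y'_def algebra_simps)
  then have "n * (Y - X) * X = n * (y - x) * X + n * y' * X - n * x' * X"
    by (simp add: distrib_left right_diff_distrib distrib_right left_diff_distrib)
  moreover have "n * x' * X = 0" using Xx A comm[of x' X] by (simp add: mult.assoc)
  moreover have "n * (Y - X) * X = - (n * n * X)"
    using nD by (simp add: right_diff_distrib)
  ultimately have "n * (y - x) * X = - (n * n * X)"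
    using ny by simp
  then have "n * n * X + n * (y - x) * X = 0" by simp
  moreover have "pos (n * n * X)" "pos (n * (y - x) * X)" using pos le by simp_all
  ultimately have nnX: "n * n * X = 0"
    using pos_add_eq_0 by blast
  have "(n * X) * (n * X) = (n * n * X) * X"
    using A comm[of X "n * X"] by (simp add: mult.assoc)
  then have "n * X = 0"
    using nnX square_eq_0[of "n * X"] pos by (simp add: pos_sa)
  then have "n * Y + n * n = 0" using nD by simp
  then have "n * n = 0" using pos_add_eq_0(2)[of "n * Y" "n * n"] pos by simp
  then have "n = 0" using pos square_eq_0 by (simp add: pos_sa)
  then have "D = pospart D" using pospart_diff_neg[OF D] by (simp add: n_def)
  then show ?thesis using D pos_pospart by (metis D_def)
qed

text \<open>Monotonicity of the positive and of the negative parts puts \<open>D\<close> between 0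
  and \<open>t - s\<close>; on the support of the part cut at \<open>t\<close> it attains
  \<open>t - s\<close>.\<close>

lemma pospart_shift:
  assumes h: "sa h" and "s \<le> t"
  defines "D \<equiv> pospart (h - s *\<^sub>R u) - pospart (h - t *\<^sub>R u)"
  shows pospart_shift_norm: "norm D \<le> t - s"
    and pospart_shift_mult: "(D - (t - s) *\<^sub>R u) * pospart (h - t *\<^sub>R u) = 0"
proof -
  define x y where "x = h - t *\<^sub>R u" and "y = h - s *\<^sub>R u"
  have xy: "sa x" "sa y" using h by (simp_all add: x_def y_def)
  have yx: "y - x = (t - s) *\<^sub>R u" by (simp add: x_def y_def algebra_simps)
  then have le: "pos (y - x)" using \<open>s \<le> t\<close> by simp
  then have le': "pos (- x - (- y))" by simp
  have D: "D = pospart y - pospart x" by (simp add: D_def x_def y_def)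
  then have D2: "D = (y + pospart (- y)) - (x + pospart (- x))"
    using xy pospart_diff_neg[of x] pospart_diff_neg[of y] by (metis diff_add_cancel)
  have D': "(t - s) *\<^sub>R u - D = pospart (- x) - pospart (- y)"
    unfolding yx[symmetric] D2 by (simp add: algebra_simps)
  have "pos ((t - s) *\<^sub>R u - D)"
    unfolding D' using xy le' by (intro pospart_mono) auto
  moreover have "pos D"
    unfolding D using xy le by (intro pospart_mono)
  ultimately have "norm D \<le> norm ((t - s) *\<^sub>R u)" by (rule norm_mono[rotated])
  also have "\<dots> \<le> t - s" using norm_unit_le \<open>s \<le> t\<close> by (simp add: mult_left_le)
  finally show "norm D \<le> t - s" .
  have "(pospart (- x) - pospart (- y)) * pospart x = 0"
    using xy le pospart_mult_neg[of x] pospart_mult_neg_mono[of x y]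
      comm[of "pospart (- x)" "pospart x"] comm[of "pospart (- y)" "pospart x"]
    by (simp add: left_diff_distrib)
  then have "((t - s) *\<^sub>R u - D) * pospart x = 0" by (simp add: D')
  then show "(D - (t - s) *\<^sub>R u) * pospart (h - t *\<^sub>R u) = 0"
    by (simp add: x_def left_diff_distrib)
qed

lemma pospart_minus_unit_eq_0:
  assumes "sa h" "norm h \<le> t"
  shows "pospart (h - t *\<^sub>R u) = 0"
  using assms pos_unit_diff[OF assms] by (intro pospart_eq_0) auto

section \<open>Inverses, cutoffs and eigenvalues\<close>

text \<open>\<open>\<delta> *\<^sub>R u + y\<close> is \<open>C\<close> times \<open>u - z\<close>
  with \<open>norm z <= c / C < 1\<close>, so its inverse is the fixed point of a contraction.
  Completeness of \<open>A\<close> keeps the inverse in \<open>A\<close>.\<close>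

lemma pos_add_unit_invertible:
  assumes y: "pos y" and "\<delta> > 0"
  obtains m where "m \<in> A" "m * (\<delta> *\<^sub>R u + y) = u"
proof -
  obtain c where c: "c \<ge> 0" "norm (c *\<^sub>R u - y) \<le> c"
    using y by (auto simp: pos_def)
  define C where "C = c + \<delta>"
  define z where "z = (1/C) *\<^sub>R (c *\<^sub>R u - y)"
  have C: "C > 0" using c \<open>\<delta> > 0\<close> by (simp add: C_def)
  have yA: "y \<in> A" using y by (rule pos_mem)
  have z: "z \<in> A" "norm z \<le> c / C" using c C yA by (auto simp: z_def divide_right_mono)
  have "\<exists>!m\<in>A. (1/C) *\<^sub>R u + z * m = m"
  proof (rule Banach_fix)
    show "complete A" using closed by (simp add: complete_eq_closed)
    show "A \<noteq> {}" using zero_mem by blast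
    show "0 \<le> c / C" "c / C < 1" using c C \<open>\<delta> > 0\<close> by (auto simp: C_def)
    show "(\<lambda>m. (1/C) *\<^sub>R u + z * m) ` A \<subseteq> A" using z by auto
    show "dist ((1/C) *\<^sub>R u + z * m) ((1/C) *\<^sub>R u + z * m') \<le> c / C * dist m m'" for m m'
    proof -
      have "norm (z * (m - m')) \<le> c / C * norm (m - m')"
        using order_trans[OF norm_mult_ineq mult_right_mono[OF z(2) norm_ge_zero]] .
      then show ?thesis by (simp add: dist_norm right_diff_distrib)
    qed
  qed
  then obtain m where m: "m \<in> A" "(1/C) *\<^sub>R u + z * m = m" by blast
  have "C *\<^sub>R m = u + (c *\<^sub>R u - y) * m"
    using C by (subst (1) m(2)[symmetric]) (simp add: z_def scaleR_add_right)
  also have "\<dots> = u + c *\<^sub>R m - y * m"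
    using m by (simp add: left_diff_distrib)
  finally have "\<delta> *\<^sub>R m + y * m = u"
    by (simp add: C_def algebra_simps)
  then have "m * (\<delta> *\<^sub>R u + y) = u"
    using m yA comm[of m y] by (simp add: distrib_left)
  then show ?thesis using that m by blast
qed

text \<open>The element \<open>m * k\<close> plays the role of \<open>min(k, \<delta>)/\<delta>\<close>, here realised as \<open>k/max(k, \<delta>)\<close>.\<close>

lemma cutoff:
  assumes k: "sa k" and "\<delta> > 0"
  obtains m where "m \<in> A" "\<And>s. s \<ge> \<delta> \<Longrightarrow> (u - m * k) * pospart (k - s *\<^sub>R u) = 0"
proof -
  have sa: "sa (k - s *\<^sub>R u)" for s using k by simp
  obtain m where m: "m \<in> A" "m * (\<delta> *\<^sub>R u + pospart (k - \<delta> *\<^sub>R u)) = u"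
    using pos_add_unit_invertible[OF _ \<open>\<delta> > 0\<close>] sa pos_pospart by blast
  \<comment> \<open>The first two terms form \<open>max(k, \<delta>)\<close>; its excess over
    \<open>k\<close> is the negative part of \<open>k - \<delta>\<close>.\<close>
  have "\<delta> *\<^sub>R u + pospart (k - \<delta> *\<^sub>R u) - k = pospart (- (k - \<delta> *\<^sub>R u))"
    using pospart_diff_neg[OF sa[of \<delta>]] by (simp add: algebra_simps)
  then have "u - m * k = m * pospart (- (k - \<delta> *\<^sub>R u))"
    using m(2) by (metis right_diff_distrib)
  moreover have "pospart (- (k - \<delta> *\<^sub>R u)) * pospart (k - s *\<^sub>R u) = 0" if "s \<ge> \<delta>" for s
  proof -
    have "(k - \<delta> *\<^sub>R u) - (k - s *\<^sub>R u) = (s - \<delta>) *\<^sub>R u" by (simp add: algebra_simps)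
    then have "pos ((k - \<delta> *\<^sub>R u) - (k - s *\<^sub>R u))" using that by simp
    then have "pospart (k - s *\<^sub>R u) * pospart (- (k - \<delta> *\<^sub>R u)) = 0"
      using sa by (intro pospart_mult_neg_mono)
    then show ?thesis
      using comm[OF pospart_mem[OF sa_minus[OF sa[of \<delta>]]] pospart_mem[OF sa[of s]]] by simp
  qed
  ultimately show ?thesis
    using that[OF m(1)] by (simp add: mult.assoc)
qed

text \<open>\<open>a\<close> is concentrated at one point of the spectrum, where \<open>h\<close> takes the value \<open>l\<close>.\<close>

lemma eigenvalue_if_indecomposable:
  assumes a: "a \<in> A" "a \<noteq> 0"
    and indec: "\<forall>x y. sa x \<longrightarrow> sa y \<longrightarrow> x * y = 0 \<longrightarrow> a * x = 0 \<or> a * y = 0"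
    and h: "sa h"
  obtains l where "a * h = l *\<^sub>R a" "\<bar>l\<bar> \<le> norm h"
proof -
  have hA: "h \<in> A" using h by (rule sa_mem)
  have le_norm: "\<bar>t\<bar> \<le> norm h" if "a * h = t *\<^sub>R a" for t
  proof -
    have "\<bar>t\<bar> * norm a \<le> norm h * norm a"
      using norm_mult_ineq[of a h] by (simp add: that mult.commute)
    then show ?thesis using a by simp
  qed
  define P where "P t = pospart (h - t *\<^sub>R u)" for t
  \<comment> \<open>\<open>N t\<close> is the negative part of \<open>h - t *\<^sub>R u\<close>,
    written as a shift of \<open>- h\<close> so that \<open>pospart_shift_norm\<close> covers it
    too.\<close>
  define N where "N t = pospart (- h - (- t) *\<^sub>R u)" for t
  have PN: "P t - N t = h - t *\<^sub>R u" "P t * N t = 0" "sa (P t)" "sa (N t)" for t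
  proof -
    have ht: "sa (h - t *\<^sub>R u)" using h by simp
    have N: "N t = pospart (- (h - t *\<^sub>R u))" by (simp add: N_def)
    show "P t - N t = h - t *\<^sub>R u" "P t * N t = 0"
      unfolding P_def N by (rule pospart_diff_neg[OF ht], rule pospart_mult_neg[OF ht])
    show "sa (P t)" "sa (N t)"
      unfolding P_def N by (intro sa_pospart sa_minus ht)+
  qed
  \<comment> \<open>\<open>U\<close> consists of the thresholds that no value of \<open>h\<close>
    seen by \<open>a\<close> exceeds; its infimum will be the eigenvalue.\<close>
  define U where "U = {t. a * P t = 0}"
  have "norm h \<in> U"
    using pospart_minus_unit_eq_0[OF h order_refl] by (simp add: U_def P_def)
  have lower: "- norm h \<le> t" if "t \<in> U" for t
  proof (rule ccontr)
    assume "\<not> ?thesis"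
    then have t: "norm (- h) \<le> - t" "norm h < \<bar>t\<bar>" by auto
    have "N t = 0"
      unfolding N_def using h t(1) by (intro pospart_minus_unit_eq_0) auto
    then have "a * (h - t *\<^sub>R u) = 0"
      using that PN(1)[of t] by (simp add: U_def)
    then have "a * h = t *\<^sub>R a" using a by (simp add: right_diff_distrib)
    then show False using le_norm t(2) by fastforce
  qed
  then have bdd: "bdd_below U" by (rule bdd_belowI)
  define l where "l = Inf U"
  have small: "a * x = 0" if "\<And>e. e > 0 \<Longrightarrow> norm (a * x) \<le> norm a * e" for x
  proof -
    have "norm (a * x) \<le> norm a * 0"
    proof (rule tendsto_lowerbound)
      show "((\<lambda>e. norm a * e) \<longlongrightarrow> norm a * 0) (at_right 0)" by (intro tendsto_intros)
      show "\<forall>\<^sub>F e in at_right 0. norm (a * x) \<le> norm a * e"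
        using eventually_at_right_less[of "0::real"] by eventually_elim (rule that)
    qed simp
    then show ?thesis by simp
  qed
  have close: "norm (a * x) \<le> norm a * e" if "a * y = 0" "norm (x - y) \<le> e" for x y e
  proof -
    have "norm (a * x) = norm (a * (x - y))" using that(1) by (simp add: right_diff_distrib)
    also have "\<dots> \<le> norm a * e"
      by (rule order_trans[OF norm_mult_ineq mult_left_mono[OF that(2) norm_ge_zero]])
    finally show ?thesis .
  qed
  have "a * P l = 0"
  proof (rule small)
    fix e :: real assume "e > 0"
    then obtain t where t: "t \<in> U" "t < l + e"
      using cInf_lessD[of U "l + e"] \<open>norm h \<in> U\<close> by (auto simp: l_def)
    then have "l \<le> t" using cInf_lower[OF _ bdd] by (simp add: l_def)
    then have "norm (P l - P t) \<le> e"
      using pospart_shift_norm[OF h, of l t] t(2) by (simp add: P_def)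
    then show "norm (a * P l) \<le> norm a * e"
      using close t(1) by (simp add: U_def)
  qed
  moreover have "a * N l = 0"
  proof (rule small)
    fix e :: real assume "e > 0"
    define t where "t = l - e"
    \<comment> \<open>Below the infimum \<open>a * P t\<close> is nonzero, so indecomposability
      forces \<open>a * N t = 0\<close>.\<close>
    have "t \<notin> U" using cInf_lower[OF _ bdd, of t] \<open>e > 0\<close> by (auto simp: t_def l_def)
    then have "a * N t = 0" using indec[rule_format, of "P t" "N t"] PN by (auto simp: U_def)
    moreover have "norm (N l - N t) \<le> e"
      using pospart_shift_norm[OF sa_minus[OF h], of "- l" "- t"] \<open>e > 0\<close>
      unfolding N_def t_def by simp
    ultimately show "norm (a * N l) \<le> norm a * e" by (rule close)
  qed
  ultimately have "a * (h - l *\<^sub>R u) = 0"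
    unfolding PN(1)[symmetric] by (simp add: right_diff_distrib)
  then have "a * h = l *\<^sub>R a" using a by (simp add: right_diff_distrib)
  then show ?thesis using that le_norm by blast
qed

end

section \<open>Orthogonality preserving maps\<close>

text \<open>\<open>Suc N\<close> equal steps from \<open>a\<close> to \<open>b\<close> change
  \<open>F\<close> by at most \<open>Suc N\<close> times \<open>M * \<eta>\<^sup>2\<close>, which is
  of order \<open>1 / N\<close>.\<close>

lemma eq_if_quadratic_increments:
  fixes F :: "real \<Rightarrow> 'b::real_normed_vector"
  assumes F: "\<And>s t. \<lbrakk>a \<le> s; s \<le> t\<rbrakk> \<Longrightarrow> norm (F s - F t) \<le> M * (t - s)\<^sup>2" and "a \<le> b"
  shows "F a = F b"
proof -
  have bound: "norm (F a - F b) \<le> M * (b - a)\<^sup>2 * inverse (real (Suc N))" for N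
  proof -
    define \<eta> where "\<eta> = (b - a) / real (Suc N)"
    have \<eta>: "\<eta> \<ge> 0" "real (Suc N) * \<eta> = b - a" using \<open>a \<le> b\<close> by (simp_all add: \<eta>_def)
    have "norm (F a - F (a + real j * \<eta>)) \<le> real j * (M * \<eta>\<^sup>2)" for j
    proof (induction j)
      case (Suc j)
      have "norm (F a - F (a + real (Suc j) * \<eta>)) \<le>
        norm (F a - F (a + real j * \<eta>)) + norm (F (a + real j * \<eta>) - F (a + real (Suc j) * \<eta>))"
        using norm_triangle_ineq[of "F a - F (a + real j * \<eta>)" "F (a + real j * \<eta>) - F (a + real (Suc j) * \<eta>)"]
        by simp
      also have "norm (F (a + real j * \<eta>) - F (a + real (Suc j) * \<eta>)) \<le> M * \<eta>\<^sup>2"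
        using F[of "a + real j * \<eta>" "a + real (Suc j) * \<eta>"] \<eta>(1) by (simp add: algebra_simps)
      finally show ?case using Suc by (simp add: algebra_simps)
    qed simp
    from this[of "Suc N"] have "norm (F a - F b) \<le> real (Suc N) * (M * \<eta>\<^sup>2)"
      unfolding \<eta>(2) by simp
    also have "\<dots> = M * (b - a)\<^sup>2 * inverse (real (Suc N))"
      by (simp add: \<eta>_def power2_eq_square divide_simps)
    finally show ?thesis .
  qed
  have "(\<lambda>N. M * (b - a)\<^sup>2 * inverse (real (Suc N))) \<longlonglongrightarrow> 0"
    by (intro tendsto_mult_right_zero LIMSEQ_inverse_real_of_nat)
  then have "norm (F a - F b) \<le> 0"
    using bound by (intro LIMSEQ_le_const) auto
  then show ?thesis by simp
qed

text \<open>Surjectivity is recorded as closedness of the range, which turns a limit of values of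
  \<open>T\<close> into some \<open>T p\<close>.\<close>

locale orthogonality_preserver = commutative_real_cstar A u
  for A :: "'a::complex_cstar_algebra set" and u +
  fixes T :: "'a \<Rightarrow> 'b::complex_cstar_algebra"
  assumes T_add: "\<lbrakk>x \<in> A; y \<in> A\<rbrakk> \<Longrightarrow> T (x + y) = T x + T y"
    and T_scaleR: "x \<in> A \<Longrightarrow> T (r *\<^sub>R x) = r *\<^sub>R T x"
    and T_orthogonal: "\<lbrakk>x \<in> A; y \<in> A; cstar_orthogonal x y\<rbrakk> \<Longrightarrow> cstar_orthogonal (T x) (T y)"
    and T_inj: "inj_on T A"
    and T_closed: "closed (T ` A)"
begin

lemma T_zero [simp]: "T 0 = 0"
  using T_scaleR[of 0 0] by simp

lemma T_minus: "x \<in> A \<Longrightarrow> T (- x) = - T x"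
  using T_scaleR[of x "-1"] by simp

lemma T_diff: "\<lbrakk>x \<in> A; y \<in> A\<rbrakk> \<Longrightarrow> T (x - y) = T x - T y"
  using T_add[of x "- y"] by (simp add: T_minus)

lemma T_orthogonalI: "\<lbrakk>x \<in> A; y \<in> A; x * adj y = 0\<rbrakk> \<Longrightarrow> cstar_orthogonal (T x) (T y)"
  using T_orthogonal orthogonalI by blast

lemma T_eq_0: "\<lbrakk>x \<in> A; T x = 0\<rbrakk> \<Longrightarrow> x = 0"
  using T_inj by (metis T_zero inj_onD zero_mem)

text \<open>The continuity ideal of \<open>T\<close>.\<close>

definition tame :: "'a \<Rightarrow> bool"
  where "tame a \<longleftrightarrow> a \<in> A \<and> (\<exists>C. \<forall>w\<in>A. norm (T (a * w)) \<le> C * norm w)"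

lemma tame_mem: "tame a \<Longrightarrow> a \<in> A"
  by (simp add: tame_def)

lemma tame_bound:
  assumes "tame a"
  obtains C where "C \<ge> 0" "\<And>w. w \<in> A \<Longrightarrow> norm (T (a * w)) \<le> C * norm w"
proof -
  obtain C where C: "\<And>w. w \<in> A \<Longrightarrow> norm (T (a * w)) \<le> C * norm w"
    using assms unfolding tame_def by blast
  have "C * norm w \<le> \<bar>C\<bar> * norm w" for w :: 'a by (simp add: mult_right_mono)
  then show ?thesis using that[of "\<bar>C\<bar>"] C order_trans by (metis abs_ge_zero)
qed

lemma tame_mult:
  assumes a: "tame a" and x: "x \<in> A"
  shows "tame (x * a)"
proof -
  obtain C where C: "C \<ge> 0" "\<And>w. w \<in> A \<Longrightarrow> norm (T (a * w)) \<le> C * norm w"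
    using tame_bound[OF a] by blast
  have "norm (T (x * a * w)) \<le> (C * norm x) * norm w" if "w \<in> A" for w
  proof -
    have "x * a * w = a * (x * w)"
      using comm[OF x tame_mem[OF a]] by (simp add: mult.assoc)
    then have "norm (T (x * a * w)) \<le> C * norm (x * w)"
      using C x that by simp
    also have "\<dots> \<le> C * (norm x * norm w)"
      by (rule mult_left_mono[OF norm_mult_ineq C(1)])
    finally show ?thesis by (simp add: mult.assoc)
  qed
  then show ?thesis using a x by (auto simp: tame_def)
qed

text \<open>A gliding hump argument.\<close>

lemma ex_tame_of_orthogonal_sequence:
  fixes b :: "nat \<Rightarrow> 'a"
  assumes b: "\<And>n. b n \<in> A" and orth: "\<And>m n. m \<noteq> n \<Longrightarrow> b m * adj (b n) = 0"
  shows "\<exists>n. tame (b n)"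
proof (rule ccontr)
  assume wild: "\<nexists>n. tame (b n)"
  have "\<exists>w\<in>A. norm (b n * w) \<le> (1/2) ^ n \<and> real n \<le> norm (T (b n * w))" for n
  proof -
    \<comment> \<open>Dividing \<open>w\<close> by \<open>N * norm w\<close> brings the norm of
      \<open>b n * w\<close> below \<open>(1/2) ^ n\<close>; the \<open>+ 1\<close> gives
      \<open>N > 0\<close> without a case distinction.\<close>
    define N where "N = 2 ^ n * (norm (b n) + 1)"
    have N: "N > 0" by (simp add: N_def add_nonneg_pos)
    obtain w where w: "w \<in> A" "norm (T (b n * w)) > (real n * N) * norm w"
      using wild b unfolding tame_def by (meson not_le)
    then have "w \<noteq> 0" by auto
    define r where "r = 1 / (N * norm w)"
    have r: "r > 0" using N \<open>w \<noteq> 0\<close> by (simp add: r_def)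
    have "norm (b n * (r *\<^sub>R w)) \<le> norm (b n) * (r * norm w)"
      using norm_mult_ineq[of "b n" "r *\<^sub>R w"] r by simp
    also have "\<dots> = norm (b n) / (norm (b n) + 1) * (1/2) ^ n"
      using \<open>w \<noteq> 0\<close> by (simp add: r_def N_def power_one_over)
    also have "\<dots> \<le> 1 * (1/2) ^ n"
      by (rule mult_right_mono) (simp_all add: divide_le_eq add_nonneg_pos)
    finally have "norm (b n * (r *\<^sub>R w)) \<le> (1/2) ^ n" by simp
    moreover have "norm (T (b n * (r *\<^sub>R w))) = r * norm (T (b n * w))"
      using w b r by (simp add: T_scaleR)
    moreover have "real n = r * (real n * N * norm w)"
      using N \<open>w \<noteq> 0\<close> by (simp add: r_def)
    then have "real n \<le> r * norm (T (b n * w))"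
      using w(2) r by (metis less_imp_le mult_left_mono)
    ultimately show ?thesis using w(1) by (metis scaleR_mem)
  qed
  then obtain w where w: "\<And>n. w n \<in> A" "\<And>n. norm (b n * w n) \<le> (1/2) ^ n"
    "\<And>n. real n \<le> norm (T (b n * w n))"
    by metis
  define f where "f n = b n * w n" for n
  have fA: "f n \<in> A" for n using b w by (simp add: f_def)
  have forth: "f m * adj (f n) = 0" if "m \<noteq> n" for m n
  proof -
    have "f m * adj (f n) = w m * (b m * adj (b n)) * adj (w n)"
      using b w comm[of "b m" "w m"] comm[of "adj (w n)" "adj (b n)"]
      by (simp add: f_def adj_mult mult.assoc)
    then show ?thesis using orth[OF that] by simp
  qed
  have "summable f"
  proof (rule summable_comparison_test)
    show "\<exists>N. \<forall>n\<ge>N. norm (f n) \<le> (1/2) ^ n" using w by (simp add: f_def)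
    show "summable (\<lambda>n. (1/2) ^ n :: real)" by (rule summable_geometric) simp
  qed
  then have lim: "(\<lambda>N. \<Sum>k<N. f k) \<longlonglongrightarrow> suminf f" by (rule summable_LIMSEQ)
  have SA: "(\<Sum>k<N. f k) \<in> A" for N using fA by (induction N) auto
  have gA: "suminf f \<in> A"
    using closed_sequentially[OF closed _ lim] SA by blast
  \<comment> \<open>\<open>T (f n)\<close> is orthogonal to the image of the rest of the series, so
    the one vector \<open>T (suminf f)\<close> dominates every \<open>T (f n)\<close> in
    norm.\<close>
  have "real n \<le> norm (T (suminf f))" for n
  proof -
    have 0: "((\<Sum>k<N. f k) - f n) * adj (f n) = 0" if "N \<ge> Suc n" for N
    proof -
      have "(\<Sum>k<N. f k) = f n + (\<Sum>k\<in>{..<N} - {n}. f k)"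
        using that by (intro sum.remove) auto
      then show ?thesis using forth by (simp add: sum_distrib_right)
    qed
    have "(\<lambda>N. ((\<Sum>k<N. f k) - f n) * adj (f n)) \<longlonglongrightarrow> (suminf f - f n) * adj (f n)"
      by (intro tendsto_intros lim)
    moreover have "(\<lambda>N. ((\<Sum>k<N. f k) - f n) * adj (f n)) \<longlonglongrightarrow> 0"
      by (rule tendsto_eventually, rule eventually_sequentiallyI) (rule 0)
    ultimately have "(suminf f - f n) * adj (f n) = 0"
      by (rule LIMSEQ_unique)
    then have "cstar_orthogonal (T (f n)) (T (suminf f - f n))"
      using gA fA by (intro cstar_orthogonal_sym[OF T_orthogonalI]) auto
    then have "norm (T (f n)) \<le> norm (T (f n) + T (suminf f - f n))"
      by (rule norm_le_norm_add_orthogonal)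
    then have "norm (T (f n)) \<le> norm (T (suminf f))"
      using gA fA by (simp add: T_diff)
    then show ?thesis using w(3)[of n] by (simp add: f_def)
  qed
  then show False using reals_Archimedean2 not_le by blast
qed

section \<open>Separating elements annihilate the continuity ideal\<close>

text \<open>
  With \<open>X\<^sub>s = T (p (k - s)\<^sup>+)\<close> the increments \<open>X\<^sub>s - X\<^sub>t\<close> are orthogonal to \<open>X\<^sub>t\<close> and of size
  \<open>O(t - s)\<close>, so \<open>X\<^sub>s X\<^sub>s\<^sup>*\<close> changes by \<open>O((t - s)\<^sup>2)\<close> and is constant; it vanishes for large \<open>s\<close>.
\<close>

lemma separating_mult_pospart_eq_0:
  assumes h: "\<And>n. h n \<in> A" "h \<longlonglongrightarrow> 0" "(\<lambda>n. T (h n)) \<longlonglongrightarrow> T p" and p: "p \<in> A"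
    and k: "sa k" "tame k" and "\<delta> > 0"
  shows "p * pospart (k - \<delta> *\<^sub>R u) = 0"
proof -
  obtain m where m: "m \<in> A" "\<And>s. s \<ge> \<delta> \<Longrightarrow> (u - m * k) * pospart (k - s *\<^sub>R u) = 0"
    using cutoff[OF k(1) \<open>\<delta> > 0\<close>] by blast
  \<comment> \<open>\<open>e\<close> is tame and acts as a unit on every \<open>K s\<close> with
    \<open>s \<ge> \<delta>\<close>.\<close>
  define e where "e = m * k"
  define K where "K s = pospart (k - s *\<^sub>R u)" for s
  define X where "X s = T (p * K s)" for s
  have "tame e" using tame_mult[OF k(2) m(1)] by (simp add: e_def)
  then obtain C where C: "C \<ge> 0" "\<And>w. w \<in> A \<Longrightarrow> norm (T (e * w)) \<le> C * norm w"
    using tame_bound by blast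
  have eA: "e \<in> A" using \<open>tame e\<close> by (rule tame_mem)
  have KA: "K s \<in> A" and Kadj: "adj (K s) = K s" for s
  proof -
    have "sa (K s)" using k(1) by (simp add: K_def)
    then show "K s \<in> A" "adj (K s) = K s" by (simp_all add: sa_def)
  qed
  have eK: "e * K s = K s" if "s \<ge> \<delta>" for s
    using m(2)[OF that] KA[of s] by (simp add: e_def K_def left_diff_distrib)
  have orthX: "cstar_orthogonal (T x) (X s)" if "x \<in> A" "x * K s = 0" for x s
  proof -
    have "x * adj (p * K s) = x * K s * adj p"
      by (simp add: adj_mult Kadj mult.assoc)
    then show ?thesis
      unfolding X_def using that p KA by (intro T_orthogonalI) auto
  qed
  \<comment> \<open>Tameness of \<open>e\<close> makes \<open>T p\<close> the limit of
    \<open>T (h n - e * h n)\<close>, and the arguments \<open>h n - e * h n\<close> annihilate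
    \<open>K s\<close>.\<close>
  have orthp: "cstar_orthogonal (T p) (X s)" if s: "s \<ge> \<delta>" for s
  proof (rule cstar_orthogonal_limit)
    have "(\<lambda>n. C * norm (h n)) \<longlonglongrightarrow> 0"
      by (intro tendsto_mult_right_zero tendsto_norm_zero h)
    then have "(\<lambda>n. T (e * h n)) \<longlonglongrightarrow> 0"
      by (rule Lim_null_comparison[rotated]) (use C h in auto)
    then show "(\<lambda>n. T (h n) - T (e * h n)) \<longlonglongrightarrow> T p"
      using tendsto_diff[OF h(3)] by fastforce
    show "cstar_orthogonal (T (h n) - T (e * h n)) (X s)" for n
    proof -
      have "(h n - e * h n) * K s = h n * (K s - e * K s)"
        using h(1) eA comm[of e "h n"] by (simp add: left_diff_distrib right_diff_distrib mult.assoc)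
      then have "cstar_orthogonal (T (h n - e * h n)) (X s)"
        using h(1) eA eK[OF s] by (intro orthX) auto
      then show ?thesis using h(1) eA by (simp add: T_diff)
    qed
  qed
  have orthpe: "cstar_orthogonal (T (p * e)) (X s)" if s: "s \<ge> \<delta>" for s
  proof -
    have "(p - p * e) * K s = 0"
      using eK[OF s] by (simp add: left_diff_distrib mult.assoc)
    then have "cstar_orthogonal (T p - T (p - p * e)) (X s)"
      using p eA by (intro cstar_orthogonal_diff[OF orthp[OF s] orthX]) auto
    then show ?thesis using p eA by (simp add: T_diff)
  qed
  \<comment> \<open>\<open>D\<close> acts on \<open>K t\<close> as the scalar \<open>t - s\<close>,
    so \<open>p * D\<close> agrees there with \<open>(t - s) *\<^sub>R (p * e)\<close>, whose image
    is orthogonal to \<open>X t\<close>.\<close>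
  have orth: "cstar_orthogonal (X s - X t) (X t)" if st: "\<delta> \<le> s" "s \<le> t" for s t
  proof -
    define D where "D = K s - K t"
    have DA: "D \<in> A" using KA by (simp add: D_def)
    have "(D - (t - s) *\<^sub>R u) * K t = 0"
      using pospart_shift_mult[OF k(1) st(2)] by (simp add: D_def K_def)
    then have "D * K t = (t - s) *\<^sub>R K t" using KA by (simp add: left_diff_distrib)
    then have "(p * D - (t - s) *\<^sub>R (p * e)) * K t = 0"
      using eK[of t] st by (simp add: left_diff_distrib mult.assoc)
    then have "cstar_orthogonal (T (p * D - (t - s) *\<^sub>R (p * e))) (X t)"
      using p DA eA by (intro orthX) auto
    moreover have "cstar_orthogonal (T ((t - s) *\<^sub>R (p * e))) (X t)"
      using orthpe[of t] st p eA by (simp add: T_scaleR cstar_orthogonal_def)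
    ultimately have "cstar_orthogonal (T (p * D - (t - s) *\<^sub>R (p * e)) + T ((t - s) *\<^sub>R (p * e))) (X t)"
      by (rule cstar_orthogonal_add)
    then have "cstar_orthogonal (T (p * D)) (X t)"
      using p DA eA by (simp add: T_diff)
    moreover have "T (p * D) = X s - X t"
      using p KA by (simp add: D_def X_def right_diff_distrib T_diff)
    ultimately show ?thesis by simp
  qed
  have lip: "norm (X s - X t) \<le> C * norm p * (t - s)" if st: "\<delta> \<le> s" "s \<le> t" for s t
  proof -
    define D where "D = K s - K t"
    have DA: "D \<in> A" using KA by (simp add: D_def)
    \<comment> \<open>This makes the bound for \<open>e\<close> available for
      \<open>T (p * D)\<close>.\<close>
    have "e * D = D" using eK st by (simp add: D_def right_diff_distrib)
    then have "p * D = e * (p * D)" using left_comm[OF eA p, of D] by simp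
    moreover have "X s - X t = T (p * D)"
      using p KA by (simp add: D_def X_def right_diff_distrib T_diff)
    ultimately have "norm (X s - X t) \<le> C * norm (p * D)"
      using C(2)[of "p * D"] p DA by simp
    also have "\<dots> \<le> C * (norm p * norm D)"
      by (rule mult_left_mono[OF norm_mult_ineq C(1)])
    also have "\<dots> \<le> C * (norm p * (t - s))"
      using C(1) pospart_shift_norm[OF k(1) st(2)] by (intro mult_left_mono) (auto simp: D_def K_def)
    finally show ?thesis by (simp add: mult.assoc)
  qed
  \<comment> \<open>At thresholds from \<open>norm k\<close> on the positive part vanishes, so
    \<open>X b = 0\<close>.\<close>
  define b where "b = max \<delta> (norm k)"
  have "X \<delta> * adj (X \<delta>) = X b * adj (X b)"
  proof (rule eq_if_quadratic_increments)
    show "\<delta> \<le> b" by (simp add: b_def)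
    fix s t assume st: "\<delta> \<le> s" "s \<le> t"
    define d where "d = X s - X t"
    have "d * adj (X t) = 0" "X t * adj d = 0"
      using orth[OF st] cstar_orthogonal_sym[OF orth[OF st]] by (auto simp: d_def cstar_orthogonal_def)
    moreover have "X s = d + X t" by (simp add: d_def)
    ultimately have "X s * adj (X s) - X t * adj (X t) = d * adj d"
      by (simp add: adj_add distrib_left distrib_right)
    moreover have "(norm d)\<^sup>2 \<le> (C * norm p * (t - s))\<^sup>2"
      using lip[OF st] by (intro power_mono) (auto simp: d_def)
    ultimately show "norm (X s * adj (X s) - X t * adj (X t)) \<le> (C * norm p)\<^sup>2 * (t - s)\<^sup>2"
      by (simp add: norm_mult_adj_self power_mult_distrib)
  qed
  moreover have "X b = 0"
    using pospart_minus_unit_eq_0[OF k(1), of b] by (simp add: X_def K_def b_def)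
  ultimately have "X \<delta> = 0" by simp
  then show ?thesis using T_eq_0[of "p * K \<delta>"] p KA by (simp add: X_def K_def)
qed

text \<open>For \<open>k = a * adj a\<close> the square \<open>k * k\<close> is its own positive
  part, so letting \<open>\<delta>\<close> tend to 0 in \<open>separating_mult_pospart_eq_0\<close>
  gives \<open>p * (k * k) = 0\<close>. The C*-identity then descends from \<open>k * k\<close> to
  \<open>k\<close> and from \<open>k\<close> to \<open>a\<close>.\<close>

lemma separating_mult_tame_eq_0:
  assumes h: "\<And>n. h n \<in> A" "h \<longlonglongrightarrow> 0" "(\<lambda>n. T (h n)) \<longlonglongrightarrow> T p" and p: "p \<in> A"
    and a: "tame a"
  shows "p * a = 0"
proof -
  have aA: "a \<in> A" using a by (rule tame_mem)
  define k where "k = a * adj a"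
  have k: "sa k" "k \<in> A" using sa_mult_adj[OF aA] by (simp_all add: k_def sa_mem)
  have "k = adj a * a" using comm[of a "adj a"] aA by (simp add: k_def)
  then have "tame k" using tame_mult[OF a, of "adj a"] aA by simp
  then have kk: "tame (k * k)" using k by (intro tame_mult)
  have kk0: "pospart (k * k) = k * k"
    using pospart_diff_neg[of "k * k"] pospart_eq_0[of "- (k * k)"] k by simp
  have "norm (p * (k * k)) \<le> norm p * \<delta>" if "\<delta> > 0" for \<delta>
  proof -
    have "p * pospart (k * k - \<delta> *\<^sub>R u) = 0"
      using separating_mult_pospart_eq_0[OF h p _ kk that] k by simp
    then have "p * (k * k) = p * (k * k - pospart (k * k - \<delta> *\<^sub>R u))"
      by (simp add: right_diff_distrib)
    moreover have "norm (k * k - pospart (k * k - \<delta> *\<^sub>R u)) \<le> \<delta>"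
      using pospart_shift_norm[of "k * k" 0 \<delta>] k that by (simp add: kk0)
    ultimately show ?thesis
      using order_trans[OF norm_mult_ineq mult_left_mono[OF _ norm_ge_zero]] by simp
  qed
  then have "norm (p * (k * k)) \<le> norm p * 0"
    by (intro tendsto_lowerbound[where F = "at_right 0" and f = "\<lambda>\<delta>. norm p * \<delta>"] tendsto_intros)
      (auto simp: eventually_at_right_less intro: eventually_mono[OF eventually_at_right_less])
  then have pkk: "p * (k * k) = 0" by simp
  have "(p * k) * adj (p * k) = p * (k * k) * adj p"
    using k by (simp add: adj_mult sa_def mult.assoc)
  then have "p * k = 0" using pkk by (metis mult_adj_self_eq_0 mult_zero_left)
  moreover have "(p * a) * adj (p * a) = p * k * adj p"
    by (simp add: adj_mult k_def mult.assoc)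
  ultimately show ?thesis by (metis mult_adj_self_eq_0 mult_zero_left)
qed

section \<open>Vanishing of the separating elements\<close>

text \<open>Self-adjoint \<open>h\<close> act on \<open>a\<close> as scalars of modulus at most
  \<open>norm h\<close>, so \<open>T (a * h)\<close> is a multiple of \<open>T a\<close>. A general
  \<open>w\<close> is split into a self-adjoint and a skew part.\<close>

lemma tame_if_indecomposable:
  assumes a: "a \<in> A" "a \<noteq> 0"
    and indec: "\<forall>x y. sa x \<longrightarrow> sa y \<longrightarrow> x * y = 0 \<longrightarrow> a * x = 0 \<or> a * y = 0"
  shows "tame a"
proof -
  have eigen: "\<exists>l. a * h = l *\<^sub>R a \<and> \<bar>l\<bar> \<le> norm h" if "sa h" for h
    using eigenvalue_if_indecomposable[OF a indec that] by blast
  have sa_part: "norm (T (a * h)) \<le> norm h * norm (T a)" if h: "sa h" for h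
  proof -
    obtain l where "a * h = l *\<^sub>R a" "\<bar>l\<bar> \<le> norm h" using eigen[OF h] by blast
    then show ?thesis using a by (simp add: T_scaleR mult_right_mono)
  qed
  have skew_mult: "sa (s * t)" if "s \<in> A" "t \<in> A" "adj s = - s" "adj t = - t" for s t
    using that comm[of s t] by (simp add: sa_def adj_mult)
  text \<open>
    Modulo the annihilator of \<open>a\<close> the algebra is \<open>\<real>\<close> or \<open>\<complex>\<close>; if \<open>s\<^sub>0\<close> is a skew element not killing
    \<open>a\<close>, every skew \<open>s\<close> acts as a multiple of \<open>s\<^sub>0\<close>.
  \<close>
  have "\<exists>M. \<forall>s\<in>A. adj s = - s \<longrightarrow> norm (T (a * s)) \<le> M * norm s"
  proof (cases "\<exists>s\<in>A. adj s = - s \<and> a * s \<noteq> 0")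
    case False
    then show ?thesis by (intro exI[of _ 0]) auto
  next
    case True
    then obtain s0 where s0: "s0 \<in> A" "adj s0 = - s0" "a * s0 \<noteq> 0" by blast
    obtain \<mu> where \<mu>: "a * (s0 * s0) = \<mu> *\<^sub>R a" using eigen skew_mult s0 by blast
    \<comment> \<open>Otherwise \<open>a * s0\<close> would be a nonzero nilpotent.\<close>
    have "\<mu> \<noteq> 0"
    proof
      assume "\<mu> = 0"
      have "(a * s0) * (a * s0) = a * (a * (s0 * s0))"
        using a s0 comm[of s0 "a * s0"] by (simp add: mult.assoc)
      then have "(a * s0) * (a * s0) = 0" using \<mu> \<open>\<mu> = 0\<close> by simp
      then show False using square_mem_eq_0[of "a * s0"] a s0 by simp
    qed
    show ?thesis
    proof (intro exI ballI impI)
      fix s assume s: "s \<in> A" "adj s = - s"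
      obtain \<nu> where \<nu>: "a * (s * s0) = \<nu> *\<^sub>R a" "\<bar>\<nu>\<bar> \<le> norm (s * s0)"
        using eigen skew_mult s s0 by blast
      have "\<mu> *\<^sub>R (a * s) = a * (s0 * s0) * s" by (simp add: \<mu>)
      also have "\<dots> = a * (s * s0) * s0"
        using s s0 comm[of "s0 * s0" s] by (simp add: mult.assoc)
      also have "\<dots> = \<nu> *\<^sub>R (a * s0)" by (simp add: \<nu>)
      finally have "a * s = (\<nu> / \<mu>) *\<^sub>R (a * s0)"
        using \<open>\<mu> \<noteq> 0\<close> by (metis divide_inverse_commute scaleR_scaleR left_inverse scaleR_one)
      then have "norm (T (a * s)) = \<bar>\<nu>\<bar> * (norm (T (a * s0)) / \<bar>\<mu>\<bar>)"
        using a s0 by (simp add: T_scaleR)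
      also have "\<dots> \<le> (norm s * norm s0) * (norm (T (a * s0)) / \<bar>\<mu>\<bar>)"
        using \<nu>(2) norm_mult_ineq[of s s0] by (intro mult_right_mono) auto
      finally show "norm (T (a * s)) \<le> (norm s0 * (norm (T (a * s0)) / \<bar>\<mu>\<bar>)) * norm s"
        by (simp add: mult_ac)
    qed
  qed
  then obtain M where M: "\<And>s. \<lbrakk>s \<in> A; adj s = - s\<rbrakk> \<Longrightarrow> norm (T (a * s)) \<le> M * norm s" by blast
  have "norm (T (a * w)) \<le> (norm (T a) + \<bar>M\<bar>) * norm w" if w: "w \<in> A" for w
  proof -
    define h s where "h = (1/2) *\<^sub>R (w + adj w)" and "s = (1/2) *\<^sub>R (w - adj w)"
    have h: "sa h" using w by (simp add: h_def sa_def adj_add adj_scaleR adj_adj add.commute)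
    have s: "s \<in> A" "adj s = - s"
      using w by (simp_all add: s_def adj_diff adj_scaleR adj_adj flip: scaleR_minus_right)
    have "norm h \<le> norm w" "norm s \<le> norm w"
      using norm_triangle_ineq[of w "adj w"] norm_triangle_ineq4[of w "adj w"]
      by (simp_all add: h_def s_def)
    then have "norm (T (a * h)) \<le> norm w * norm (T a)" "norm (T (a * s)) \<le> \<bar>M\<bar> * norm w"
      using order_trans[OF sa_part[OF h] mult_right_mono[OF _ norm_ge_zero]]
        order_trans[OF M[OF s] order_trans[OF mult_right_mono[OF abs_ge_self norm_ge_zero]
          mult_left_mono[OF _ abs_ge_zero]]]
      by auto
    moreover have "w = h + s"
      by (simp add: h_def s_def flip: scaleR_add_right)
    then have "T (a * w) = T (a * h) + T (a * s)"
      using a h s by (simp add: distrib_left T_add sa_mem)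
    ultimately show ?thesis
      using norm_triangle_ineq[of "T (a * h)" "T (a * s)"] by (simp add: algebra_simps)
  qed
  then show ?thesis using a unfolding tame_def by blast
qed

text \<open>If \<open>p\<close> is nonzero, no nonzero element of the ideal \<open>p A\<close> is
  tame, so each one splits by \<open>tame_if_indecomposable\<close>. Repeated splitting produces a
  sequence that contradicts \<open>ex_tame_of_orthogonal_sequence\<close>.\<close>

lemma eq_0_if_annihilates_tame:
  assumes p: "p \<in> A" and ann: "\<And>a. tame a \<Longrightarrow> p * a = 0"
  shows "p = 0"
proof (rule ccontr)
  assume "p \<noteq> 0"
  \<comment> \<open>A tame \<open>p * q\<close> is annihilated by \<open>p\<close>, hence has square
    0.\<close>
  have zero: "p * q = 0" if "q \<in> A" "tame (p * q)" for q
  proof -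
    have "(p * q) * (p * q) = (p * (p * q)) * q"
      using p that comm[of q "p * q"] by (simp add: mult.assoc)
    then show ?thesis using ann[OF that(2)] square_mem_eq_0[of "p * q"] p that by simp
  qed
  define S where "S = {p * q |q. q \<in> A} - {0}"
  have S: "a \<in> A" "a \<noteq> 0" "\<not> tame a" if "a \<in> S" for a
    using that p zero by (auto simp: S_def)
  have S_mult: "a * x \<in> S" if "a \<in> S" "x \<in> A" "a * x \<noteq> 0" for a x
  proof -
    obtain q where "q \<in> A" "a = p * q" using \<open>a \<in> S\<close> by (auto simp: S_def)
    then have "a * x = p * (q * x)" "q * x \<in> A" using that by (simp_all add: mult.assoc)
    then show ?thesis using that(3) by (auto simp: S_def)
  qed
  have "\<exists>x y. sa x \<and> sa y \<and> x * y = 0 \<and> a * x \<noteq> 0 \<and> a * y \<noteq> 0" if "a \<in> S" for a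
    using S[OF that] tame_if_indecomposable by blast
  then obtain x y where xy: "\<And>a. a \<in> S \<Longrightarrow> sa (x a)" "\<And>a. a \<in> S \<Longrightarrow> sa (y a)"
    "\<And>a. a \<in> S \<Longrightarrow> x a * y a = 0" "\<And>a. a \<in> S \<Longrightarrow> a * x a \<noteq> 0" "\<And>a. a \<in> S \<Longrightarrow> a * y a \<noteq> 0"
    by metis
  \<comment> \<open>Of the two pieces of \<open>c n\<close>, the one with \<open>x\<close> is split
    further, and the one with \<open>y\<close> becomes \<open>b n\<close>.\<close>
  define c where "c = rec_nat p (\<lambda>_ a. a * x a)"
  have c0: "c 0 = p" and cS: "c (Suc n) = c n * x (c n)" for n by (simp_all add: c_def)
  have "p = p * u" using p by simp
  then have "p \<in> S" using \<open>p \<noteq> 0\<close> unit_mem unfolding S_def by blast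
  have cS': "c n \<in> S" for n
  proof (induction n)
    case (Suc n)
    show ?case
      unfolding cS by (rule S_mult[OF Suc sa_mem[OF xy(1)[OF Suc]] xy(4)[OF Suc]])
  qed (simp add: c0 \<open>p \<in> S\<close>)
  have xyA: "x (c n) \<in> A" "y (c n) \<in> A" "c n \<in> A" for n by (rule sa_mem xy cS' S(1))+
  \<comment> \<open>Every later \<open>c m\<close> carries the factor \<open>x (c n)\<close>, which
    the factor \<open>y (c n)\<close> of \<open>b n\<close> annihilates.\<close>
  have factor: "\<exists>z\<in>A. c m = c n * x (c n) * z" if "n < m" for n m
    using that
  proof (induction m)
    case (Suc m)
    show ?case
    proof (cases "n = m")
      case True
      then show ?thesis using xyA by (intro bexI[of _ u]) (auto simp: cS)
    next
      case False
      then obtain z where "z \<in> A" "c m = c n * x (c n) * z" using Suc by auto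
      then have "c m * v = c n * x (c n) * (z * v)" for v by (simp add: mult.assoc)
      then have "c (Suc m) = c n * x (c n) * (z * x (c m))" by (simp only: cS)
      then show ?thesis using mult_mem[OF \<open>z \<in> A\<close> xyA(1)] by blast
    qed
  qed simp
  define b where "b n = c n * y (c n)" for n
  have bA: "b n \<in> A" for n using xyA by (simp add: b_def)
  have rearrange: "(r * s * t * v) * (w * d) = (s * w) * (r * t * v * d)"
    if "r \<in> A" "s \<in> A" "t \<in> A" "v \<in> A" "w \<in> A" "d \<in> A" for r s t v w d
    using that by (simp add: mult.assoc comm left_comm)
  have lt: "b m * adj (b n) = 0" if "n < m" for m n
  proof -
    obtain z where z: "z \<in> A" "c m = c n * x (c n) * z" using factor \<open>n < m\<close> by blast
    have "adj (y (c n)) = y (c n)" using xy(2)[OF cS'] by (simp add: sa_def)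
    then have "b m * adj (b n) = (c n * x (c n) * z * y (c m)) * (y (c n) * adj (c n))"
      using z(2) by (simp only: b_def adj_mult)
    also have "\<dots> = (x (c n) * y (c n)) * (c n * z * y (c m) * adj (c n))"
      using z(1) xyA by (intro rearrange) auto
    finally have "b m * adj (b n) = (x (c n) * y (c n)) * (c n * z * y (c m) * adj (c n))" .
    then show ?thesis using xy(3)[OF cS'] by simp
  qed
  have "\<exists>n. tame (b n)"
  proof (rule ex_tame_of_orthogonal_sequence[OF bA])
    fix m n :: nat assume "m \<noteq> n"
    then consider "n < m" | "m < n" by linarith
    then show "b m * adj (b n) = 0"
    proof cases
      case 2
      then have "adj (b n * adj (b m)) = 0" using lt by simp
      then show ?thesis by (simp add: adj_mult adj_adj)
    qed (rule lt)
  qed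
  moreover have "b n \<in> S" for n
    unfolding b_def by (rule S_mult[OF cS' xyA(2) xy(5)[OF cS']])
  ultimately show False using S(3) by blast
qed

lemma T_bounded:
  obtains C where "C \<ge> 0" "\<And>x. x \<in> A \<Longrightarrow> norm (T x) \<le> C * norm x"
proof -
  have graph: "g = 0" if h: "\<And>n. h n \<in> A" "h \<longlonglongrightarrow> 0" and g: "(\<lambda>n. T (h n)) \<longlonglongrightarrow> g"
    for h :: "nat \<Rightarrow> 'a" and g
  proof -
    \<comment> \<open>The closed range makes the limit a value \<open>T p\<close>; this
      \<open>p\<close> annihilates all tame elements and so is 0.\<close>
    have "g \<in> T ` A"
      using closed_sequentially[OF T_closed _ g] h(1) by blast
    then obtain p where p: "p \<in> A" "g = T p" by blast
    then have "p = 0"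
      using eq_0_if_annihilates_tame separating_mult_tame_eq_0[OF h] g by blast
    then show "g = 0" using p by simp
  qed
  show ?thesis
  proof (rule closed_graph_bounded[OF closed subsp])
    fix C :: real
    assume "C \<ge> 0" "\<And>x. x \<in> A \<Longrightarrow> norm (T x) \<le> C * norm x"
    then show thesis by (rule that)
  qed (fact T_add, fact T_scaleR, use graph in blast)
qed

end

theorem theorem3p10:
  fixes A :: "'a::complex_cstar_algebra set"
    and B :: "'b::complex_cstar_algebra set"
    and T :: "'a \<Rightarrow> 'b"
  assumes "real_cstar_algebra A" and "commutative_on A" and "unital_on A"
    and "real_cstar_algebra B" and "commutative_on B" and "unital_on B"
    and "real_linear_on A T"
    and "bij_betw T A B"
    and "orthogonality_preserving_on A T"
  shows "continuous_on A T"
proof -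
  obtain u where u: "u \<in> A" "\<forall>x\<in>A. u * x = x \<and> x * u = x"
    using assms(3) by (auto simp: unital_on_def)
  have TA: "T ` A = B" "inj_on T A"
    using assms(8) by (auto simp: bij_betw_def)
  interpret orthogonality_preserver A u T
    using assms(1,2,4,7,9) u TA
    by unfold_locales
      (auto simp: real_cstar_algebra_def commutative_on_def real_linear_on_def
        orthogonality_preserving_on_def)
  obtain C where C: "C \<ge> 0" "\<And>x. x \<in> A \<Longrightarrow> norm (T x) \<le> C * norm x"
    using T_bounded by blast
  have "C-lipschitz_on A T"
    using C by (intro lipschitz_onI) (auto simp: dist_norm simp flip: T_diff)
  then show ?thesis by (rule lipschitz_on_continuous_on)
qed

end
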